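(* Suppose that we are given: (a) $n<\omega$ and cardinals $\kappa_n<\dots<\kappa_0<\kappa_{-1}=\lambda$; (b) for each $0\le\ell\leq n$, a normal $\kappa_\ell$-complete nonprincipal ultrafilter $E_\ell$ on the uncountable cardinal $\kappa_\ell$; (c) a $\lambda$-saturated model $M_0$ which is, or contains, a dense linear order $<$; (d) $M_{\ell+1}=(M_\ell)^{\kappa_\ell}/E_\ell$ for $0\le\ell\leq n$. Then (cuts being taken in the interpretation of the linear order $<$): ($\alpha$) for $0\le\ell\leq n$, $M_{\ell+1}$ is $\kappa_\ell$-saturated; ($\beta$) if $0\le\ell<k\leq n+1$ then $M_k$ has a $(\kappa_\ell^+,\kappa_\ell^+)$-cut; ($\gamma$) for $0\le i\leq n$ and $0\le\ell\leq n+1$, $M_\ell$ has no $(\kappa_i,\kappa_i)$-cut; ($\delta$) for $0\le\ell\leq n+1$, $M_\ell$ has no $(\theta,\theta)$-cut for any weakly compact $\theta<\lambda$. Thus, for each $\ell\leq n$, $M_{n+1}$ has a $(\kappa_\ell^+,\kappa_\ell^+)$-cut, and for any weakly compact $\theta<\lambda$, in particular $\theta=\kappa_\ell$, $M_{n+1}$ has no $(\theta,\theta)$-cut.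
   Context: All languages are countable. A filter $D$ on $\kappa$ is normal if for every sequence $\langle A_i : i<\kappa\rangle$ of members of $D$, $\{\alpha<\kappa : (\forall j<1+\alpha)(\alpha\in A_j)\}\in D$. An ultrafilter is $\mu$-complete if it is closed under intersections of fewer than $\mu$ of its members. An uncountable cardinal $\theta$ is weakly compact if $\theta\to(\theta)^2_2$. A $(\kappa_1,\kappa_2)$-cut in a linear order $L$ consists of a strictly increasing sequence $\langle a_i : i<\kappa_1\rangle$ and a strictly decreasing sequence $\langle b_j: j<\kappa_2\rangle$ in $L$ with $a_i<b_j$ for all $i,j$, such that no $x\in L$ satisfies $a_i<x<b_j$ for all $i<\kappa_1$, $j<\kappa_2$. *)

theory Defs
  imports Main "HOL-Library.FuncSet" "HOL-Library.Countable_Set" "HOL-Library.Ramsey"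
begin

unbundle cardinal_syntax

section \<open>First-order logic\<close>

text \<open>
  A language is given by its function and relation symbols together with their arities;
  constants are function symbols of arity 0.
\<close>

record ('f, 'r) language =
  funcs :: "('f \<times> nat) set"
  rels :: "('r \<times> nat) set"

definition countable_language :: "('f, 'r) language \<Rightarrow> bool" where
  "countable_language L \<longleftrightarrow> countable (funcs L) \<and> countable (rels L)"

datatype 'f trm = Var nat | Fn 'f "'f trm list"

datatype ('f, 'r) fm =
    Falsum
  | Equal "'f trm" "'f trm"
  | Rel 'r "'f trm list"
  | Imp "('f, 'r) fm" "('f, 'r) fm"
  | All nat "('f, 'r) fm"

fun fv_trm :: "'f trm \<Rightarrow> nat set" where
  "fv_trm (Var x) = {x}"
| "fv_trm (Fn f ts) = (\<Union>t\<in>set ts. fv_trm t)"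

fun fv :: "('f, 'r) fm \<Rightarrow> nat set" where
  "fv Falsum = {}"
| "fv (Equal s t) = fv_trm s \<union> fv_trm t"
| "fv (Rel p ts) = (\<Union>t\<in>set ts. fv_trm t)"
| "fv (Imp \<phi> \<psi>) = fv \<phi> \<union> fv \<psi>"
| "fv (All x \<phi>) = fv \<phi> - {x}"

fun is_trm :: "('f, 'r) language \<Rightarrow> 'f trm \<Rightarrow> bool" where
  "is_trm L (Var x) \<longleftrightarrow> True"
| "is_trm L (Fn f ts) \<longleftrightarrow> (f, length ts) \<in> funcs L \<and> (\<forall>t\<in>set ts. is_trm L t)"

fun is_fm :: "('f, 'r) language \<Rightarrow> ('f, 'r) fm \<Rightarrow> bool" where
  "is_fm L Falsum \<longleftrightarrow> True"
| "is_fm L (Equal s t) \<longleftrightarrow> is_trm L s \<and> is_trm L t"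
| "is_fm L (Rel p ts) \<longleftrightarrow> (p, length ts) \<in> rels L \<and> (\<forall>t\<in>set ts. is_trm L t)"
| "is_fm L (Imp \<phi> \<psi>) \<longleftrightarrow> is_fm L \<phi> \<and> is_fm L \<psi>"
| "is_fm L (All x \<phi>) \<longleftrightarrow> is_fm L \<phi>"

record ('f, 'r, 'm) struct =
  carrier :: "'m set"
  fint :: "'f \<Rightarrow> 'm list \<Rightarrow> 'm"
  rint :: "'r \<Rightarrow> 'm list \<Rightarrow> bool"

definition is_model :: "('f, 'r) language \<Rightarrow> ('f, 'r, 'm) struct \<Rightarrow> bool" where
  "is_model L M \<longleftrightarrow> carrier M \<noteq> {} \<and>
     (\<forall>(f, n)\<in>funcs L. \<forall>as. length as = n \<longrightarrow> set as \<subseteq> carrier M \<longrightarrow> fint M f as \<in> carrier M)"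

fun val :: "('f, 'r, 'm) struct \<Rightarrow> (nat \<Rightarrow> 'm) \<Rightarrow> 'f trm \<Rightarrow> 'm" where
  "val M e (Var x) = e x"
| "val M e (Fn f ts) = fint M f (map (val M e) ts)"

fun sat :: "('f, 'r, 'm) struct \<Rightarrow> (nat \<Rightarrow> 'm) \<Rightarrow> ('f, 'r) fm \<Rightarrow> bool" where
  "sat M e Falsum \<longleftrightarrow> False"
| "sat M e (Equal s t) \<longleftrightarrow> val M e s = val M e t"
| "sat M e (Rel p ts) \<longleftrightarrow> rint M p (map (val M e) ts)"
| "sat M e (Imp \<phi> \<psi>) \<longleftrightarrow> (sat M e \<phi> \<longrightarrow> sat M e \<psi>)"
| "sat M e (All x \<phi>) \<longleftrightarrow> (\<forall>a\<in>carrier M. sat M (e(x := a)) \<phi>)"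

text \<open>
  Isomorphism lets a chain of iterated ultrapowers, whose literal members have ever larger
  types, be given as a family \<open>M :: nat \<Rightarrow> ('f, 'r, 'm) struct\<close> of models on carriers of one type
  \<open>'m\<close>, each the ultrapower of its predecessor up to isomorphism.  As finitely many ultrapowers
  are taken and \<open>'m\<close> is arbitrary, this is no restriction.
\<close>

definition isomorphic ::
  "('f, 'r) language \<Rightarrow> ('f, 'r, 'm) struct \<Rightarrow> ('f, 'r, 'n) struct \<Rightarrow> bool" where
  "isomorphic L M N \<longleftrightarrow> (\<exists>h. bij_betw h (carrier M) (carrier N) \<and>
     (\<forall>(f, n)\<in>funcs L. \<forall>as. length as = n \<longrightarrow> set as \<subseteq> carrier M \<longrightarrow>
        h (fint M f as) = fint N f (map h as)) \<and>
     (\<forall>(p, n)\<in>rels L. \<forall>as. length as = n \<longrightarrow> set as \<subseteq> carrier M \<longrightarrow>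
        (rint M p as \<longleftrightarrow> rint N p (map h as))))"


section \<open>Saturation\<close>

text \<open>
  A formula in the free variable 0 with parameters from \<open>A\<close> is a pair \<open>(\<phi>, e)\<close>, where
  \<open>e\<close> names the parameters that are substituted for the other free variables of \<open>\<phi>\<close>.
\<close>

definition param_fms :: "('f, 'r) language \<Rightarrow> 'm set \<Rightarrow> (('f, 'r) fm \<times> (nat \<Rightarrow> 'm)) set" where
  "param_fms L A = {(\<phi>, e). is_fm L \<phi> \<and> e ` (fv \<phi> - {0}) \<subseteq> A}"

definition realizes ::
  "('f, 'r, 'm) struct \<Rightarrow> 'm \<Rightarrow> (('f, 'r) fm \<times> (nat \<Rightarrow> 'm)) set \<Rightarrow> bool" where
  "realizes M b p \<longleftrightarrow> (\<forall>(\<phi>, e)\<in>p. sat M (e(0 := b)) \<phi>)"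

text \<open>Cardinals are the relations \<open>\<kappa>\<close> with \<open>Card_order \<kappa>\<close>, i.e. initial ordinals on \<open>Field \<kappa>\<close>.\<close>

definition saturated :: "('f, 'r) language \<Rightarrow> 'k rel \<Rightarrow> ('f, 'r, 'm) struct \<Rightarrow> bool" where
  "saturated L \<kappa> M \<longleftrightarrow> (\<forall>A p. A \<subseteq> carrier M \<longrightarrow> |A| <o \<kappa> \<longrightarrow> p \<subseteq> param_fms L A \<longrightarrow>
     (\<forall>q. finite q \<longrightarrow> q \<subseteq> p \<longrightarrow> (\<exists>b\<in>carrier M. realizes M b q)) \<longrightarrow>
     (\<exists>b\<in>carrier M. realizes M b p))"


section \<open>Ultrafilters and ultrapowers\<close>

definition ultrafilter_on :: "'i set \<Rightarrow> 'i set set \<Rightarrow> bool" where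
  "ultrafilter_on I D \<longleftrightarrow> D \<subseteq> Pow I \<and> I \<in> D \<and> {} \<notin> D \<and>
     (\<forall>A\<in>D. \<forall>B\<in>D. A \<inter> B \<in> D) \<and>
     (\<forall>A\<in>D. \<forall>B. A \<subseteq> B \<longrightarrow> B \<subseteq> I \<longrightarrow> B \<in> D) \<and>
     (\<forall>A. A \<subseteq> I \<longrightarrow> A \<in> D \<or> I - A \<in> D)"

definition nonprincipal_on :: "'i set \<Rightarrow> 'i set set \<Rightarrow> bool" where
  "nonprincipal_on I D \<longleftrightarrow> (\<forall>i\<in>I. {i} \<notin> D)"

definition complete_on :: "'i set \<Rightarrow> 'k rel \<Rightarrow> 'i set set \<Rightarrow> bool" where
  "complete_on I \<mu> D \<longleftrightarrow> (\<forall>S. S \<subseteq> D \<longrightarrow> |S| <o \<mu> \<longrightarrow> I \<inter> \<Inter>S \<in> D)"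

text \<open>
  The ordinal \<open>1 + \<alpha>\<close>, for an element \<open>\<alpha>\<close> of a well-order without a last element:
  it is the successor of \<open>\<alpha>\<close> if \<open>\<alpha>\<close> is finite, and \<open>\<alpha>\<close> itself otherwise.
\<close>

definition one_plus :: "'k rel \<Rightarrow> 'k \<Rightarrow> 'k" where
  "one_plus r \<alpha> = (if finite (underS r \<alpha>) then wo_rel.suc r {\<alpha>} else \<alpha>)"

definition normal_on :: "'k rel \<Rightarrow> 'k set set \<Rightarrow> bool" where
  "normal_on \<kappa> D \<longleftrightarrow> (\<forall>A. (\<forall>i\<in>Field \<kappa>. A i \<in> D) \<longrightarrow>
     {\<alpha> \<in> Field \<kappa>. \<forall>j\<in>underS \<kappa> (one_plus \<kappa> \<alpha>). \<alpha> \<in> A j} \<in> D)"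

definition ueq :: "'i set \<Rightarrow> 'i set set \<Rightarrow> ('f, 'r, 'm) struct \<Rightarrow> ('i \<Rightarrow> 'm) rel" where
  "ueq I D M = {(g, h). g \<in> I \<rightarrow>\<^sub>E carrier M \<and> h \<in> I \<rightarrow>\<^sub>E carrier M \<and> {i \<in> I. g i = h i} \<in> D}"

definition ultrapower ::
  "'i set \<Rightarrow> 'i set set \<Rightarrow> ('f, 'r, 'm) struct \<Rightarrow> ('f, 'r, ('i \<Rightarrow> 'm) set) struct" where
  "ultrapower I D M =
     \<lparr> carrier = (I \<rightarrow>\<^sub>E carrier M) // ueq I D M,
       fint = (\<lambda>f cs. ueq I D M `` {\<lambda>i\<in>I. fint M f (map (\<lambda>c. (SOME g. g \<in> c) i) cs)}),
       rint = (\<lambda>p cs. {i \<in> I. rint M p (map (\<lambda>c. (SOME g. g \<in> c) i) cs)} \<in> D) \<rparr>"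


section \<open>Weakly compact cardinals\<close>

text \<open>\<open>\<theta> \<rightarrow> (\<theta>)\<^sup>2\<^sub>2\<close>\<close>

definition arrows_pairs :: "'k rel \<Rightarrow> bool" where
  "arrows_pairs \<theta> \<longleftrightarrow> (\<forall>c \<in> nsets (Field \<theta>) 2 \<rightarrow> {..<2::nat}.
     \<exists>H \<xi>. H \<subseteq> Field \<theta> \<and> |H| =o \<theta> \<and> \<xi> < 2 \<and> c ` nsets H 2 \<subseteq> {\<xi>})"

definition uncountable_cardinal :: "'k rel \<Rightarrow> bool" where
  "uncountable_cardinal \<theta> \<longleftrightarrow> Card_order \<theta> \<and> natLeq <o \<theta>"

definition weakly_compact :: "'k rel \<Rightarrow> bool" where
  "weakly_compact \<theta> \<longleftrightarrow> uncountable_cardinal \<theta> \<and> arrows_pairs \<theta>"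


section \<open>Linear orders and cuts\<close>

text \<open>
  The linear order \<open><\<close> of a structure is the interpretation of a binary relation symbol.
  It is taken as a strict order on its own field, which may be the whole carrier or a proper
  subset of it.  Dense linear orders are understood to have at least two elements, so every
  point of the order lies in the field.
\<close>

definition ord_of :: "('f, 'r, 'm) struct \<Rightarrow> 'r \<Rightarrow> 'm rel" where
  "ord_of M lt = {(x, y). x \<in> carrier M \<and> y \<in> carrier M \<and> rint M lt [x, y]}"

definition dense_linear_order :: "'m rel \<Rightarrow> bool" where
  "dense_linear_order R \<longleftrightarrow> strict_linear_order_on (Field R) R \<and> R \<noteq> {} \<and>
     (\<forall>x y. (x, y) \<in> R \<longrightarrow> (\<exists>z. (x, z) \<in> R \<and> (z, y) \<in> R))"

definition has_cut :: "'m rel \<Rightarrow> 'i rel \<Rightarrow> 'j rel \<Rightarrow> bool" where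
  "has_cut R \<kappa>\<^sub>1 \<kappa>\<^sub>2 \<longleftrightarrow> (\<exists>a b.
     a ` Field \<kappa>\<^sub>1 \<subseteq> Field R \<and> b ` Field \<kappa>\<^sub>2 \<subseteq> Field R \<and>
     (\<forall>i' i. i' \<in> underS \<kappa>\<^sub>1 i \<longrightarrow> (a i', a i) \<in> R) \<and>
     (\<forall>j' j. j' \<in> underS \<kappa>\<^sub>2 j \<longrightarrow> (b j, b j') \<in> R) \<and>
     (\<forall>i\<in>Field \<kappa>\<^sub>1. \<forall>j\<in>Field \<kappa>\<^sub>2. (a i, b j) \<in> R) \<and>
     \<not> (\<exists>x\<in>Field R. \<forall>i\<in>Field \<kappa>\<^sub>1. \<forall>j\<in>Field \<kappa>\<^sub>2. (a i, x) \<in> R \<and> (x, b j) \<in> R))"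

end

theory Submission
  imports Defs
begin

text \<open>
  One ultrapower step \<open>N = M\<^sup>\<kappa> / E\<close> by a normal measure is studied through the linear orders \<open>R\<close> of
  \<open>M\<close> and \<open>S\<close> of \<open>N\<close>, where \<open>M\<close> is saturated at a cardinal above \<open>\<kappa>\<close>.  Of this saturation, the
  arguments about cuts use only that two sets of at most \<open>\<kappa>\<close> points, one below the other, have a point
  between them.  The effect of the step on symmetric cuts depends on how the cofinality compares with
  \<open>\<kappa>\<close>.

  Below \<open>\<kappa>\<close>, the ultrapower is \<open>\<kappa>\<close>-saturated (\<open>saturated_ultrapower\<close>): a type over fewer than \<open>\<kappa>\<close>
  parameters has fewer than \<open>\<kappa>\<close> finite subsets, so by completeness and the theorem of Los it is finitely
  satisfiable at almost every coordinate, and it is realized there.  Hence there are no such cuts.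

  At \<open>\<kappa>\<close>, normality lets a candidate for a \<open>(\<kappa>, \<kappa>)\<close>-cut be filled coordinate by coordinate, as
  coordinate \<open>i\<close> has to respect only the terms of index below \<open>i\<close> (\<open>no_cut_at_measure\<close>).

  At \<open>\<kappa>\<^sup>+\<close>, a cut appears (\<open>cut_at_cardSuc\<close>).  The ordinals \<open>\<alpha> < \<kappa>\<^sup>+\<close> are approximated at coordinate
  \<open>i\<close> by sets \<open>u \<alpha> i \<subseteq> \<alpha>\<close> of size below \<open>\<kappa>\<close>, such that \<open>u \<beta> i\<close> end-extends \<open>u \<alpha> i\<close> at almost every \<open>i\<close>
  when \<open>\<alpha> < \<beta>\<close>.  The tree of these sets is embedded into the intervals of \<open>R\<close>, with inclusion for
  end extension and disjointness for incomparability.  A point in all intervals of the branch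
  \<open>\<langle>u \<alpha> : \<alpha> < \<kappa>\<^sup>+\<rangle>\<close> would give at each coordinate a subset of \<open>\<kappa>\<^sup>+\<close> of size at most \<open>\<kappa>\<close>, hence bounded,
  although these sets cover \<open>\<kappa>\<^sup>+\<close>.

  Above \<open>\<kappa>\<close>, cuts of regular cofinality persist, represented by constant functions
  (\<open>cut_preserved\<close>).  So the \<open>(\<kappa>\<^sup>+, \<kappa>\<^sup>+)\<close>-cut survives the later steps, which use smaller measurable
  cardinals.  Conversely, if \<open>\<theta> > \<kappa>\<close> is weakly compact and \<open>R\<close> has no \<open>(\<theta>, \<theta>)\<close>-cut, then neither has
  \<open>S\<close> (\<open>weakly_compact_no_cut\<close>): weak compactness thins out a sequence of functions of length \<open>\<theta>\<close> so
  that it is monotone at almost every coordinate.  The property used is that \<open>\<theta>\<close> many \<open>0\<close>-\<open>1\<close>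
  functions on at most \<open>\<theta>\<close> coordinates have a subfamily of size \<open>\<theta>\<close> that is eventually constant
  in each coordinate (\<open>stabilizing_subset\<close>).

  Finally, a normal measure makes its cardinal weakly compact, which is the case \<open>\<theta> = \<kappa> l\<close>, and the
  theorem follows by induction on the steps.
\<close>

section \<open>Well-orders and regular cardinals\<close>

lemma underS_total:
  assumes "Well_order r" "x \<in> Field r" "y \<in> Field r"
  shows "x \<in> underS r y \<or> x = y \<or> y \<in> underS r x"
proof -
  interpret wo_rel r using assms(1) by (simp add: wo_rel_def)
  show ?thesis using TOTALS assms(2,3) by (auto simp: underS_def)
qed

lemma underS_trans:
  assumes "Well_order r" "x \<in> underS r y" "y \<in> underS r z"
  shows "x \<in> underS r z"
proof -
  interpret wo_rel r using assms(1) by (simp add: wo_rel_def)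
  show ?thesis using TRANS ANTISYM assms(2,3) by (auto simp: underS_def dest: transD antisymD)
qed

lemma underS_irrefl: "x \<notin> underS r x"
  by (simp add: underS_def)

lemma underS_asym:
  assumes "Well_order r" "x \<in> underS r y"
  shows "y \<notin> underS r x"
  using underS_trans[OF assms] underS_irrefl by metis

lemma underS_in_Field:
  assumes "x \<in> underS r y"
  shows "x \<in> Field r" "y \<in> Field r"
  using assms by (auto simp: underS_def Field_def)

lemma Well_order_least:
  assumes "Well_order r" "A \<subseteq> Field r" "x \<in> A"
  obtains m where "m \<in> A" "\<And>y. y \<in> underS r m \<Longrightarrow> y \<notin> A"
proof -
  have "wf (r - Id)" using assms(1) by (simp add: well_order_on_def)
  then obtain m where "m \<in> A" "\<And>y. (y, m) \<in> r - Id \<Longrightarrow> y \<notin> A"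
    using assms(3) by (rule wfE_min) blast
  then show thesis using that by (auto simp: underS_def)
qed

lemma Well_order_induct_underS [consumes 2, case_names less]:
  assumes "Well_order r" "x \<in> Field r"
    and step: "\<And>x. x \<in> Field r \<Longrightarrow> (\<And>y. y \<in> underS r x \<Longrightarrow> P y) \<Longrightarrow> P x"
  shows "P x"
proof (rule ccontr)
  assume "\<not> P x"
  then obtain m where "m \<in> {y \<in> Field r. \<not> P y}" "\<And>y. y \<in> underS r m \<Longrightarrow> y \<notin> {y \<in> Field r. \<not> P y}"
    using Well_order_least[OF assms(1), of "{y \<in> Field r. \<not> P y}" x] assms(2) by auto
  then show False using step[of m] underS_in_Field by fastforce
qed

lemma wf_underS:
  assumes "Well_order r"
  shows "wf {(x, y). x \<in> underS r y}"
proof -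
  have "{(x, y). x \<in> underS r y} = r - Id" by (auto simp: underS_def)
  then show ?thesis using assms by (simp add: well_order_on_def)
qed

lemma Card_order_underS_upper:
  assumes "Card_order r" "infinite (Field r)" "x \<in> Field r" "y \<in> Field r"
  obtains z where "z \<in> Field r" "x \<in> underS r z" "y \<in> underS r z"
proof -
  have W: "Well_order r" using assms(1) by (simp add: card_order_on_def)
  have *: "\<exists>z\<in>Field r. u \<in> underS r z" if "u \<in> Field r" for u
    using infinite_Card_order_limit[OF assms(1,2) that] by (auto simp: underS_def)
  show thesis using underS_total[OF W assms(3,4)] * assms(3,4) underS_trans[OF W] that by metis
qed

lemma regularCard_bounded:
  assumes "Card_order r" "infinite (Field r)" "regularCard r" "X \<subseteq> Field r" "|X| <o r"
  obtains z where "z \<in> Field r" "X \<subseteq> underS r z"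
proof -
  have W: "Well_order r" using assms(1) by (simp add: card_order_on_def)
  have "\<not> cofinal X r"
    using assms(3,4,5) not_ordLess_ordIso unfolding regularCard_def by blast
  then obtain a where a: "a \<in> Field r" "\<And>x. x \<in> X \<Longrightarrow> a \<notin> underS r x"
    unfolding cofinal_def underS_def by auto
  obtain z where z: "z \<in> Field r" "a \<in> underS r z"
    using Card_order_underS_upper[OF assms(1,2) a(1) a(1)] by blast
  have "x \<in> underS r z" if "x \<in> X" for x
    using underS_total[OF W a(1), of x] a(2)[OF that] that assms(4) z underS_trans[OF W] by blast
  then show thesis using that z by blast
qed

lemma large_set_unbounded:
  assumes "Card_order r" "infinite (Field r)" "H \<subseteq> Field r" "|H| =o r" "x \<in> Field r"
  obtains y where "y \<in> H" "x \<in> underS r y"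
proof (rule ccontr)
  assume *: "\<not> thesis"
  have W: "Well_order r" using assms(1) by (simp add: card_order_on_def)
  obtain z where z: "z \<in> Field r" "x \<in> underS r z"
    using Card_order_underS_upper[OF assms(1,2,5,5)] by blast
  have "H \<subseteq> underS r z"
    using * that z assms(3) underS_total[OF W assms(5)] underS_trans[OF W] by blast
  then have "|H| <o r"
    using card_of_mono1 card_of_underS[OF assms(1) z(1)] ordLeq_ordLess_trans by blast
  then show False using assms(4) not_ordLess_ordIso by blast
qed

lemma card_of_image_ordLess: "|X| <o r \<Longrightarrow> |f ` X| <o r"
  using card_of_image ordLeq_ordLess_trans by blast

lemma card_of_subset_ordLess: "|X| <o r \<Longrightarrow> Y \<subseteq> X \<Longrightarrow> |Y| <o r"
  using card_of_mono1 ordLeq_ordLess_trans by blast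

lemma not_ordLess_imp_ordIso:
  assumes "Card_order r" "X \<subseteq> Field r" "\<not> |X| <o r"
  shows "|X| =o r"
proof -
  have "|X| \<le>o r"
    using card_of_mono1[OF assms(2)] card_of_Field_ordIso[OF assms(1)] ordLeq_ordIso_trans by blast
  then show ?thesis using assms(3) ordLeq_iff_ordLess_or_ordIso by blast
qed

lemma Field_Restr_Well_order:
  assumes "Well_order r" "B \<subseteq> Field r"
  shows "Field (Restr r B) = B"
proof -
  have "Refl r" using assms(1) by (simp add: order_on_defs)
  then show ?thesis using Refl_Field_Restr2 assms(2) by blast
qed

text \<open>
  A proper initial segment of \<open>B\<close> is a well-order of fewer than \<open>k\<close> points, and so it is shorter than
  the initial ordinal \<open>k\<close>.
\<close>

lemma Restr_ordLeq_Card_order: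
  assumes "Card_order k" "Well_order r" "B \<subseteq> Field r"
    and small: "\<And>x. x \<in> B \<Longrightarrow> |B \<inter> underS r x| <o k"
  shows "Restr r B \<le>o k"
proof -
  have W: "Well_order (Restr r B)" using Well_order_Restr[OF assms(2)] .
  have "Well_order k" using assms(1) by (simp add: card_order_on_def)
  then show ?thesis
  proof (subst ordLeq_iff_ordLess_Restr[OF W], assumption, intro ballI)
    fix a assume a: "a \<in> Field (Restr r B)"
    let ?s = "Restr (Restr r B) (underS (Restr r B) a)"
    have "underS (Restr r B) a \<subseteq> B \<inter> underS r a" by (auto simp: underS_def)
    then have "Field ?s \<subseteq> B \<inter> underS r a" by (auto simp: Field_def)
    then have *: "|Field ?s| <o k"
      using small[of a] a Field_Restr_Well_order[OF assms(2,3)] card_of_subset_ordLess by blast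
    show "?s <o k"
    proof (rule ccontr)
      assume "\<not> ?s <o k"
      then have "k \<le>o ?s"
        using ordLess_or_ordLeq[OF Well_order_Restr[OF W]] assms(1) unfolding card_order_on_def by blast
      then have "|Field k| \<le>o |Field ?s|" by (rule card_of_mono2)
      then have "|Field k| <o k" using * ordLeq_ordLess_trans by blast
      then show False using card_of_Field_ordIso[OF assms(1)] not_ordLess_ordIso by blast
    qed
  qed
qed

lemma card_of_small_initial_segments:
  assumes "Card_order k" "Well_order r" "B \<subseteq> Field r"
    and "\<And>x. x \<in> B \<Longrightarrow> |B \<inter> underS r x| <o k"
  shows "|B| \<le>o k"
proof -
  have "Restr r B \<le>o k" using assms by (rule Restr_ordLeq_Card_order)
  then have "|Field (Restr r B)| \<le>o |Field k|" by (rule card_of_mono2)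
  then show ?thesis
    unfolding Field_Restr_Well_order[OF assms(2,3)]
    using card_of_Field_ordIso[OF assms(1)] by (rule ordLeq_ordIso_trans)
qed

lemma Restr_large_ordIso:
  assumes "Card_order r" "H \<subseteq> Field r" "|H| =o r"
  shows "Restr r H =o r"
proof -
  have W: "Well_order r" using assms(1) by (simp add: card_order_on_def)
  have "well_order_on H (Restr r H)"
    using Well_order_Restr[OF W, of H] Field_Restr_Well_order[OF W assms(2)] by simp
  then have "|H| \<le>o Restr r H" by (rule card_of_least)
  then have "r \<le>o Restr r H" using assms(3) ordIso_ordLeq_trans ordIso_symmetric by blast
  moreover have "Restr r H \<le>o r"
  proof (rule Restr_ordLeq_Card_order[OF assms(1) W assms(2)])
    fix x assume "x \<in> H"
    then have "|underS r x| <o r" using card_of_underS[OF assms(1)] assms(2) by blast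
    then show "|H \<inter> underS r x| <o r" by (rule card_of_subset_ordLess) blast
  qed
  ultimately show ?thesis using ordIso_iff_ordLeq by blast
qed

lemma card_of_singleton_ordLeq:
  assumes "Card_order r" "infinite (Field r)"
  shows "|{x}| \<le>o r"
proof -
  have "Field r \<noteq> {}" using assms(2) by auto
  then have "|{x}| \<le>o |Field r|" by (rule card_of_singl_ordLeq)
  then show ?thesis using card_of_Field_ordIso[OF assms(1)] by (rule ordLeq_ordIso_trans)
qed

lemma infinite_Field_natLeq:
  assumes "natLeq <o r"
  shows "infinite (Field r)"
  using card_of_mono2[OF ordLess_imp_ordLeq[OF assms]] Field_natLeq infinite_iff_card_of_nat by metis

lemma cardSuc_bounded:
  assumes "Card_order k" "infinite (Field k)" "X \<subseteq> Field (cardSuc k)" "|X| \<le>o k"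
  obtains z where "z \<in> Field (cardSuc k)" "X \<subseteq> underS (cardSuc k) z"
proof -
  have "|X| <o cardSuc k" using assms card_of_Card_order cardSuc_ordLeq_ordLess by blast
  then show thesis
    using regularCard_bounded[OF cardSuc_Card_order[OF assms(1)] _ infinite_cardSuc_regularCard[OF assms(2,1)] assms(3)]
      cardSuc_finite[OF assms(1)] assms(2) that by blast
qed

section \<open>Weakly compact cardinals\<close>

locale weakly_compact_cardinal =
  fixes \<theta> :: "'k rel"
  assumes weakly_compact: "weakly_compact \<theta>"
begin

lemma Card: "Card_order \<theta>" and wo: "Well_order \<theta>" and inf: "infinite (Field \<theta>)"
proof -
  show 1: "Card_order \<theta>"
    using weakly_compact by (simp add: weakly_compact_def uncountable_cardinal_def)
  then show "Well_order \<theta>" by (simp add: card_order_on_def)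
  show "infinite (Field \<theta>)"
    using weakly_compact by (simp add: weakly_compact_def uncountable_cardinal_def infinite_Field_natLeq)
qed

text \<open>
  The colouring is transported to \<open>\<theta>\<close> by a bijection with \<open>H\<close>.  This need not preserve the order,
  so the colour of a pair refers to the order of the images.
\<close>

lemma homogeneous_set:
  assumes "H \<subseteq> Field \<theta>" "|H| =o \<theta>"
  obtains H' where "H' \<subseteq> H" "|H'| =o \<theta>"
    "(\<forall>x\<in>H'. \<forall>y\<in>H'. x \<in> underS \<theta> y \<longrightarrow> P x y) \<or>
     (\<forall>x\<in>H'. \<forall>y\<in>H'. x \<in> underS \<theta> y \<longrightarrow> \<not> P x y)"
proof -
  have "|Field \<theta>| =o |H|"
    using assms(2) card_of_Field_ordIso[OF Card] ordIso_transitive ordIso_symmetric by blast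
  then obtain f where f: "bij_betw f (Field \<theta>) H" using card_of_ordIso by blast
  define c where "c S = (if \<exists>x\<in>S. \<exists>y\<in>S. f x \<in> underS \<theta> (f y) \<and> P (f x) (f y) then 1 else 0 :: nat)"
    for S
  have "c \<in> nsets (Field \<theta>) 2 \<rightarrow> {..<2}" by (auto simp: c_def)
  then obtain K \<xi> where K: "K \<subseteq> Field \<theta>" "|K| =o \<theta>" "c ` nsets K 2 \<subseteq> {\<xi>}"
    using weakly_compact unfolding weakly_compact_def arrows_pairs_def by blast
  have inj: "inj_on f K" using f K(1) by (auto simp: bij_betw_def intro: inj_on_subset)
  have "|f ` K| =o \<theta>"
    using K(2) card_of_ordIsoI[OF inj_on_imp_bij_betw[OF inj]] ordIso_symmetric ordIso_transitive
    by blast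
  moreover have "f ` K \<subseteq> H" using f K(1) by (auto simp: bij_betw_def)
  moreover have "P x y \<longleftrightarrow> \<xi> = 1" if xy: "x \<in> f ` K" "y \<in> f ` K" "x \<in> underS \<theta> y" for x y
  proof -
    obtain u v where uv: "u \<in> K" "v \<in> K" "x = f u" "y = f v" using xy by auto
    have "u \<noteq> v" using xy(3) uv underS_irrefl by metis
    then have "{u, v} \<in> nsets K 2" using uv by (auto simp: nsets_def)
    then have "c {u, v} = \<xi>" using K(3) by blast
    moreover have "c {u, v} = 1 \<longleftrightarrow> P x y" "c {u, v} \<le> 1"
      using xy(3) uv underS_asym[OF wo xy(3)] by (auto simp: c_def underS_irrefl)
    ultimately show ?thesis by auto
  qed
  ultimately show thesis using that[of "f ` K"] by blast
qed

text \<open>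
  The colouring of pairs by whether their members lie below the same point of a small cofinal
  set of bounds has no large homogeneous set: a class of the colouring is bounded, and there are
  too few classes for a large set of points in different ones.
\<close>

lemma regular: "regularCard \<theta>"
  unfolding regularCard_def
proof (intro allI impI, rule ccontr)
  fix K assume K: "K \<subseteq> Field \<theta> \<and> cofinal K \<theta>" and "\<not> |K| =o \<theta>"
  then have small: "|K| <o \<theta>" using not_ordLess_imp_ordIso[OF Card] by blast
  have "\<forall>x\<in>Field \<theta>. \<exists>y. y \<in> K \<and> x \<in> underS \<theta> y"
    using K unfolding cofinal_def underS_def by blast
  then obtain k where k: "\<And>x. x \<in> Field \<theta> \<Longrightarrow> k x \<in> K \<and> x \<in> underS \<theta> (k x)" by metis
  have large: "|Field \<theta>| =o \<theta>" using card_of_Field_ordIso[OF Card] .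
  obtain H where H: "H \<subseteq> Field \<theta>" "|H| =o \<theta>"
    "(\<forall>x\<in>H. \<forall>y\<in>H. x \<in> underS \<theta> y \<longrightarrow> k x = k y) \<or>
     (\<forall>x\<in>H. \<forall>y\<in>H. x \<in> underS \<theta> y \<longrightarrow> k x \<noteq> k y)"
    by (rule homogeneous_set[OF subset_refl large])
  have "H \<noteq> {}" using large_set_unbounded[OF Card inf H(1,2)] inf by (metis empty_iff finite.emptyI ex_in_conv)
  then obtain x where x: "x \<in> H" by blast
  from H(3) show False
  proof
    assume *: "\<forall>x\<in>H. \<forall>y\<in>H. x \<in> underS \<theta> y \<longrightarrow> k x = k y"
    have "k x \<in> Field \<theta>" using k x H(1) K by blast
    then obtain y where y: "y \<in> H" "k x \<in> underS \<theta> y"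
      using large_set_unbounded[OF Card inf H(1,2)] by blast
    have "x \<in> underS \<theta> y" using y(2) k x H(1) underS_trans[OF wo] by blast
    then have "k x = k y" using * x y by blast
    then show False using y k[of y] H(1) underS_asym[OF wo] by (metis subsetD)
  next
    assume *: "\<forall>x\<in>H. \<forall>y\<in>H. x \<in> underS \<theta> y \<longrightarrow> k x \<noteq> k y"
    have "inj_on k H"
      using * underS_total[OF wo] H(1) by (metis inj_onI subsetD)
    then have "|H| \<le>o |K|" using k H(1) by (intro card_of_ordLeqI) auto
    then show False using small H(2) ordLeq_ordLess_trans not_ordLess_ordIso by blast
  qed
qed

lemmas bounded = regularCard_bounded[OF Card inf regular]
lemmas unbounded = large_set_unbounded[OF Card inf]
lemmas upper = Card_order_underS_upper[OF Card inf]

end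

definition lex_less :: "'i rel \<Rightarrow> ('i \<Rightarrow> 'v::linorder) \<Rightarrow> ('i \<Rightarrow> 'v) \<Rightarrow> bool" where
  "lex_less W s t \<longleftrightarrow> (\<exists>\<xi>\<in>Field W. s \<xi> < t \<xi> \<and> (\<forall>\<eta>\<in>underS W \<xi>. s \<eta> = t \<eta>))"

lemma lex_lessI:
  "\<xi> \<in> Field W \<Longrightarrow> s \<xi> < t \<xi> \<Longrightarrow> (\<And>\<eta>. \<eta> \<in> underS W \<xi> \<Longrightarrow> s \<eta> = t \<eta>) \<Longrightarrow> lex_less W s t"
  by (auto simp: lex_less_def)

lemma lex_less_trans:
  assumes "Well_order W" "lex_less W s t" "lex_less W t u"
  shows "lex_less W s u"
proof -
  obtain \<xi> where \<xi>: "\<xi> \<in> Field W" "s \<xi> < t \<xi>" "\<And>\<eta>. \<eta> \<in> underS W \<xi> \<Longrightarrow> s \<eta> = t \<eta>"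
    using assms(2) by (auto simp: lex_less_def)
  obtain \<zeta> where \<zeta>: "\<zeta> \<in> Field W" "t \<zeta> < u \<zeta>" "\<And>\<eta>. \<eta> \<in> underS W \<zeta> \<Longrightarrow> t \<eta> = u \<eta>"
    using assms(3) by (auto simp: lex_less_def)
  consider "\<xi> \<in> underS W \<zeta>" | "\<xi> = \<zeta>" | "\<zeta> \<in> underS W \<xi>" using underS_total[OF assms(1) \<xi>(1) \<zeta>(1)] by blast
  then show ?thesis
  proof cases
    case 1
    then show ?thesis
      using \<xi> \<zeta> underS_trans[OF assms(1) _ 1] by (intro lex_lessI[of \<xi>]) metis+
  next
    case 2
    then show ?thesis using \<xi> \<zeta> by (intro lex_lessI[of \<xi>]) auto
  next
    case 3
    then show ?thesis
      using \<xi> \<zeta> underS_trans[OF assms(1) _ 3] by (intro lex_lessI[of \<zeta>]) metis+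
  qed
qed

lemma lex_less_irrefl: "\<not> lex_less W s s"
  by (auto simp: lex_less_def)

lemma lex_less_compl: "lex_less W (\<lambda>x. \<not> s x) (\<lambda>x. \<not> t x) = lex_less W t s"
  by (auto simp: lex_less_def)

context weakly_compact_cardinal
begin

lemma lex_increasing_stabilizes:
  fixes s :: "'k \<Rightarrow> 'i \<Rightarrow> bool"
  assumes W: "Well_order W" "\<And>\<xi>. \<xi> \<in> Field W \<Longrightarrow> |underS W \<xi>| <o \<theta>"
    and H: "H \<subseteq> Field \<theta>"
    and inc: "\<And>x y. x \<in> H \<Longrightarrow> y \<in> H \<Longrightarrow> x \<in> underS \<theta> y \<Longrightarrow> \<not> lex_less W (s y) (s x)"
    and \<xi>: "\<xi> \<in> Field W"
  shows "\<exists>\<beta>\<in>Field \<theta>. \<forall>x\<in>H. \<forall>y\<in>H. \<beta> \<in> underS \<theta> x \<longrightarrow> \<beta> \<in> underS \<theta> y \<longrightarrow> s x \<xi> = s y \<xi>"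
  using W(1) \<xi>
proof (induction rule: Well_order_induct_underS)
  case (less \<xi>)
  define stable where "stable \<eta> \<beta> \<longleftrightarrow> \<beta> \<in> Field \<theta> \<and>
    (\<forall>x\<in>H. \<forall>y\<in>H. \<beta> \<in> underS \<theta> x \<longrightarrow> \<beta> \<in> underS \<theta> y \<longrightarrow> s x \<eta> = s y \<eta>)" for \<eta> \<beta>
  have "\<forall>\<eta>\<in>underS W \<xi>. \<exists>\<beta>. stable \<eta> \<beta>" using less.IH unfolding stable_def by blast
  then obtain b where b: "\<And>\<eta>. \<eta> \<in> underS W \<xi> \<Longrightarrow> stable \<eta> (b \<eta>)" by metis
  have "b ` underS W \<xi> \<subseteq> Field \<theta>" using b by (auto simp: stable_def)
  then obtain \<beta> where \<beta>: "\<beta> \<in> Field \<theta>" "b ` underS W \<xi> \<subseteq> underS \<theta> \<beta>"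
    using bounded card_of_image_ordLess[OF W(2)[OF less.hyps]] by metis
  have agree: "s x \<eta> = s y \<eta>"
    if "x \<in> H" "y \<in> H" "\<beta> \<in> underS \<theta> x" "\<beta> \<in> underS \<theta> y" "\<eta> \<in> underS W \<xi>" for x y \<eta>
    using b[OF that(5)] that \<beta> underS_trans[OF wo] unfolding stable_def by blast
  have up: "s y \<xi>" if "x \<in> H" "y \<in> H" "\<beta> \<in> underS \<theta> x" "x \<in> underS \<theta> y" "s x \<xi>" for x y
  proof (rule ccontr)
    assume "\<not> s y \<xi>"
    then have "lex_less W (s y) (s x)"
      using agree[OF that(2,1) underS_trans[OF wo that(3,4)] that(3)] that(5)
      by (intro lex_lessI[OF less.hyps]) auto
    then show False using inc[OF that(1,2,4)] by blast
  qed
  show ?case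
  proof (cases "\<exists>x\<in>H. \<beta> \<in> underS \<theta> x \<and> s x \<xi>")
    case True
    then obtain x where x: "x \<in> H" "\<beta> \<in> underS \<theta> x" "s x \<xi>" by blast
    then have "\<forall>y\<in>H. x \<in> underS \<theta> y \<longrightarrow> s y \<xi>" using up by blast
    then show ?thesis using x(1) H by blast
  next
    case False
    then show ?thesis using \<beta>(1) by blast
  qed
qed

text \<open>
  This consequence of the partition property takes the place of the tree property.  The colouring
  of the pairs \<open>x < y\<close> by the lexicographic order of \<open>s x\<close> and \<open>s y\<close> has a large homogeneous set,
  on which \<open>s\<close> is monotone.  By induction on the coordinate, a monotone sequence of \<open>0\<close>-\<open>1\<close>
  functions of regular length stabilizes at each coordinate: once all earlier coordinates
  are constant, this coordinate is monotone.
\<close>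

lemma stabilizing_subset:
  fixes s :: "'k \<Rightarrow> 'i \<Rightarrow> bool"
  assumes "|I| \<le>o \<theta>"
  obtains H where "H \<subseteq> Field \<theta>" "|H| =o \<theta>"
    "\<forall>\<xi>\<in>I. \<exists>\<beta>\<in>Field \<theta>. \<forall>x\<in>H. \<forall>y\<in>H. \<beta> \<in> underS \<theta> x \<longrightarrow> \<beta> \<in> underS \<theta> y \<longrightarrow> s x \<xi> = s y \<xi>"
proof -
  let ?W = "|I|"
  note W = card_of_Well_order[of I] Field_card_of[of I]
    ordLess_ordLeq_trans[OF card_of_underS[OF card_of_Card_order[of I]] assms]
  obtain H where H: "H \<subseteq> Field \<theta>" "|H| =o \<theta>"
    "(\<forall>x\<in>H. \<forall>y\<in>H. x \<in> underS \<theta> y \<longrightarrow> lex_less ?W (s y) (s x)) \<or>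
     (\<forall>x\<in>H. \<forall>y\<in>H. x \<in> underS \<theta> y \<longrightarrow> \<not> lex_less ?W (s y) (s x))"
    by (rule homogeneous_set[OF subset_refl card_of_Field_ordIso[OF Card]])
  show thesis
  proof (rule that[OF H(1,2)], rule ballI)
    fix \<xi> assume "\<xi> \<in> I"
    then have \<xi>: "\<xi> \<in> Field ?W" using W(2) by simp
    from H(3) show "\<exists>\<beta>\<in>Field \<theta>. \<forall>x\<in>H. \<forall>y\<in>H. \<beta> \<in> underS \<theta> x \<longrightarrow> \<beta> \<in> underS \<theta> y \<longrightarrow> s x \<xi> = s y \<xi>"
    proof
      assume "\<forall>x\<in>H. \<forall>y\<in>H. x \<in> underS \<theta> y \<longrightarrow> lex_less ?W (s y) (s x)"
      then have "\<not> lex_less ?W (s x) (s y)" if "x \<in> H" "y \<in> H" "x \<in> underS \<theta> y" for x y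
        using that lex_less_trans[OF W(1)] lex_less_irrefl by metis
      then show ?thesis
        using lex_increasing_stabilizes[OF W(1,3) H(1) _ \<xi>, of "\<lambda>x i. \<not> s x i"]
        by (simp add: lex_less_compl)
    next
      assume "\<forall>x\<in>H. \<forall>y\<in>H. x \<in> underS \<theta> y \<longrightarrow> \<not> lex_less ?W (s y) (s x)"
      then show ?thesis using lex_increasing_stabilizes[OF W(1,3) H(1) _ \<xi>, of s] by blast
    qed
  qed
qed

end

section \<open>Linear orders with filled gaps\<close>

lemma dense_linear_orderD:
  assumes "dense_linear_order R"
  shows "trans R" "irrefl R" "total_on (Field R) R" "R \<noteq> {}"
    "\<And>x y. (x, y) \<in> R \<Longrightarrow> \<exists>z. (x, z) \<in> R \<and> (z, y) \<in> R"
  using assms by (auto simp: dense_linear_order_def strict_linear_order_on_def)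

lemma finite_has_maximum:
  assumes "dense_linear_order R" "finite A" "A \<noteq> {}" "A \<subseteq> Field R"
  shows "\<exists>m\<in>A. \<forall>x\<in>A. x = m \<or> (x, m) \<in> R"
  using assms(2-4)
proof (induction A rule: finite_ne_induct)
  case (insert a A)
  then obtain m where m: "m \<in> A" "\<forall>x\<in>A. x = m \<or> (x, m) \<in> R" by auto
  have "a = m \<or> (a, m) \<in> R \<or> (m, a) \<in> R"
    using dense_linear_orderD(3)[OF assms(1)] insert.prems m(1) unfolding total_on_def by blast
  then consider "a = m \<or> (a, m) \<in> R" | "(m, a) \<in> R" by blast
  then show ?case
  proof cases
    case 1
    then show ?thesis using m by (intro bexI[of _ m]) auto
  next
    case 2
    then have "x = a \<or> (x, a) \<in> R" if "x \<in> A" for x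
      using m(2) that transD[OF dense_linear_orderD(1)[OF assms(1)]] by metis
    then show ?thesis by (intro bexI[of _ a]) auto
  qed
qed auto

lemma finite_has_minimum:
  assumes "dense_linear_order R" "finite A" "A \<noteq> {}" "A \<subseteq> Field R"
  shows "\<exists>m\<in>A. \<forall>x\<in>A. x = m \<or> (m, x) \<in> R"
  using assms(2-4)
proof (induction A rule: finite_ne_induct)
  case (insert a A)
  then obtain m where m: "m \<in> A" "\<forall>x\<in>A. x = m \<or> (m, x) \<in> R" by auto
  have "a = m \<or> (m, a) \<in> R \<or> (a, m) \<in> R"
    using dense_linear_orderD(3)[OF assms(1)] insert.prems m(1) unfolding total_on_def by blast
  then consider "a = m \<or> (m, a) \<in> R" | "(a, m) \<in> R" by blast
  then show ?case
  proof cases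
    case 1
    then show ?thesis using m by (intro bexI[of _ m]) auto
  next
    case 2
    then have "x = a \<or> (a, x) \<in> R" if "x \<in> A" for x
      using m(2) that transD[OF dense_linear_orderD(1)[OF assms(1)]] by metis
    then show ?thesis by (intro bexI[of _ a]) auto
  qed
qed auto

text \<open>
  The consequence of saturation that the arguments about cuts use.  The two sets are nonempty
  because a dense order may have end points.
\<close>

definition fills_gaps :: "'m rel \<Rightarrow> 'k rel \<Rightarrow> bool" where
  "fills_gaps R \<kappa> \<longleftrightarrow> (\<forall>A B. A \<noteq> {} \<longrightarrow> B \<noteq> {} \<longrightarrow> |A| \<le>o \<kappa> \<longrightarrow> |B| \<le>o \<kappa> \<longrightarrow> A \<times> B \<subseteq> R \<longrightarrow>
     (\<exists>x. \<forall>a\<in>A. \<forall>b\<in>B. (a, x) \<in> R \<and> (x, b) \<in> R))"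

lemma fills_gapsD:
  assumes "fills_gaps R \<kappa>" "A \<noteq> {}" "B \<noteq> {}" "|A| \<le>o \<kappa>" "|B| \<le>o \<kappa>"
    "\<And>a b. a \<in> A \<Longrightarrow> b \<in> B \<Longrightarrow> (a, b) \<in> R"
  obtains x where "x \<in> Field R" "\<And>a. a \<in> A \<Longrightarrow> (a, x) \<in> R" "\<And>b. b \<in> B \<Longrightarrow> (x, b) \<in> R"
proof -
  have "A \<times> B \<subseteq> R" using assms(6) by blast
  then obtain x where x: "\<forall>a\<in>A. \<forall>b\<in>B. (a, x) \<in> R \<and> (x, b) \<in> R"
    using assms(1-5) unfolding fills_gaps_def by metis
  then have "x \<in> Field R" using assms(2,3) unfolding Field_def by blast
  then show thesis using that x assms(2,3) by blast
qed

definition cut_sequences :: "'m rel \<Rightarrow> 'i rel \<Rightarrow> ('i \<Rightarrow> 'm) \<Rightarrow> ('i \<Rightarrow> 'm) \<Rightarrow> bool" where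
  "cut_sequences R r a b \<longleftrightarrow>
     a ` Field r \<subseteq> Field R \<and> b ` Field r \<subseteq> Field R \<and>
     (\<forall>i' i. i' \<in> underS r i \<longrightarrow> (a i', a i) \<in> R) \<and>
     (\<forall>j' j. j' \<in> underS r j \<longrightarrow> (b j, b j') \<in> R) \<and>
     (\<forall>i\<in>Field r. \<forall>j\<in>Field r. (a i, b j) \<in> R) \<and>
     \<not> (\<exists>x\<in>Field R. \<forall>i\<in>Field r. \<forall>j\<in>Field r. (a i, x) \<in> R \<and> (x, b j) \<in> R)"

lemma has_cut_iff: "has_cut R r r \<longleftrightarrow> (\<exists>a b. cut_sequences R r a b)"
  unfolding has_cut_def cut_sequences_def by (rule refl)

lemma cut_sequencesD:
  assumes "cut_sequences R r a b"
  shows "i \<in> Field r \<Longrightarrow> a i \<in> Field R" "i \<in> Field r \<Longrightarrow> b i \<in> Field R"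
    "i \<in> underS r j \<Longrightarrow> (a i, a j) \<in> R" "i \<in> underS r j \<Longrightarrow> (b j, b i) \<in> R"
    "i \<in> Field r \<Longrightarrow> j \<in> Field r \<Longrightarrow> (a i, b j) \<in> R"
  using assms unfolding cut_sequences_def by (simp_all add: image_subset_iff)

lemma cut_sequences_unfilled:
  assumes "cut_sequences R r a b" "x \<in> Field R"
  obtains i j where "i \<in> Field r" "j \<in> Field r" "(a i, x) \<notin> R \<or> (x, b j) \<notin> R"
proof -
  have "\<not> (\<exists>x\<in>Field R. \<forall>i\<in>Field r. \<forall>j\<in>Field r. (a i, x) \<in> R \<and> (x, b j) \<in> R)"
    using assms(1) unfolding cut_sequences_def by (elim conjE)
  then show thesis using assms(2) that by blast
qed

lemma fills_gaps_no_cut: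
  assumes "fills_gaps R \<kappa>" "Card_order \<kappa>" "Card_order r" "r \<le>o \<kappa>" "Field r \<noteq> {}"
  shows "\<not> has_cut R r r"
proof
  assume "has_cut R r r"
  then obtain a b where ab: "cut_sequences R r a b" unfolding has_cut_iff by (elim exE)
  have small: "|f ` Field r| \<le>o \<kappa>" for f :: "_ \<Rightarrow> 'a"
    using ordLeq_transitive[OF ordLeq_ordIso_trans[OF card_of_image card_of_Field_ordIso[OF assms(3)]] assms(4)] .
  obtain x where x: "x \<in> Field R" "\<And>y. y \<in> a ` Field r \<Longrightarrow> (y, x) \<in> R" "\<And>y. y \<in> b ` Field r \<Longrightarrow> (x, y) \<in> R"
    by (rule fills_gapsD[OF assms(1) _ _ small small, of a b]) (use cut_sequencesD(5)[OF ab] assms(5) in auto)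
  obtain i j where "i \<in> Field r" "j \<in> Field r" "(a i, x) \<notin> R \<or> (x, b j) \<notin> R"
    using cut_sequences_unfilled[OF ab x(1)] .
  then show False using x(2,3) by blast
qed

text \<open>
  Gaps are filled one after the other along a well-order of \<open>Q\<close> whose proper initial segments
  have size at most \<open>\<kappa>\<close>.
\<close>

lemma embed_partial_order:
  fixes R :: "'m rel" and Q :: "'q set" and lt :: "'q \<Rightarrow> 'q \<Rightarrow> bool"
  assumes R: "dense_linear_order R" "fills_gaps R \<kappa>"
    and \<kappa>: "Card_order \<kappa>" "infinite (Field \<kappa>)"
    and Q: "|Q| \<le>o cardSuc \<kappa>"
    and lt: "\<And>x y z. lt x y \<Longrightarrow> lt y z \<Longrightarrow> lt x z" "\<And>x. \<not> lt x x"
  obtains g where "\<And>x. x \<in> Q \<Longrightarrow> g x \<in> Field R"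
    "\<And>x y. x \<in> Q \<Longrightarrow> y \<in> Q \<Longrightarrow> lt x y \<Longrightarrow> (g x, g y) \<in> R"
proof -
  let ?W = "|Q|"
  \<comment> \<open>The image is kept between two fixed points, as \<open>R\<close> may have end points.\<close>
  obtain c d where cd: "(c, d) \<in> R" using dense_linear_orderD(4)[OF R(1)] by auto
  note tr = transD[OF dense_linear_orderD(1)[OF R(1)]]
  define ok where "ok f q x \<longleftrightarrow> (q \<in> Q \<longrightarrow> (c, x) \<in> R \<and> (x, d) \<in> R \<and>
    (\<forall>p\<in>underS ?W q. (lt p q \<longrightarrow> (f p, x) \<in> R) \<and> (lt q p \<longrightarrow> (x, f p) \<in> R)))" for f q x
  have "\<exists>g. \<forall>q. ok g q (g q)"
  proof (rule dependent_wf_choice[OF wf_underS[OF card_of_Well_order[of Q]]])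
    fix f g :: "'q \<Rightarrow> 'm" and q x
    assume "\<And>z. (z, q) \<in> {(x, y). x \<in> underS ?W y} \<Longrightarrow> f z = g z"
    then have "f p = g p" if "p \<in> underS ?W q" for p using that by simp
    then show "ok f q x = ok g q x" unfolding ok_def by auto
  next
    fix q f
    assume "\<And>p. (p, q) \<in> {(x, y). x \<in> underS ?W y} \<Longrightarrow> ok f p (f p)"
    then have IH: "ok f p (f p)" if "p \<in> underS ?W q" for p using that by simp
    show "\<exists>x. ok f q x"
    proof (cases "q \<in> Q")
      case True
      let ?U = "underS ?W q"
      have UQ: "p \<in> Q" if "p \<in> ?U" for p using underS_in_Field[OF that] by (simp add: Field_card_of)
      have "|?U| <o ?W" using card_of_underS[OF card_of_Card_order] True by (simp add: Field_card_of)
      then have "|?U| \<le>o \<kappa>"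
        using Q ordLess_ordLeq_trans cardSuc_ordLeq_ordLess[OF \<kappa>(1) card_of_Card_order] by blast
      moreover have "|insert e (f ` X)| \<le>o \<kappa>" if "|?U| \<le>o \<kappa>" "X \<subseteq> ?U" for e X
      proof -
        have "|f ` X| \<le>o \<kappa>" using that card_of_image card_of_mono1 ordLeq_transitive by metis
        then have "|{e} \<union> f ` X| \<le>o \<kappa>" using card_of_Un_ordLeq_infinite_Field[OF \<kappa>(2) card_of_singleton_ordLeq[OF \<kappa>] _ \<kappa>(1)] by simp
        then show ?thesis by simp
      qed
      ultimately have small: "|insert e (f ` X)| \<le>o \<kappa>" if "X \<subseteq> ?U" for e X using that by blast
      let ?A = "{p \<in> ?U. lt p q}" and ?B = "{p \<in> ?U. lt q p}"
      have between: "(f p, f p') \<in> R" if "p \<in> ?A" "p' \<in> ?B" for p p'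
      proof -
        have pp': "lt p p'" "p \<in> ?U" "p' \<in> ?U" using lt(1) that by auto
        then have "p \<in> underS ?W p' \<or> p' \<in> underS ?W p"
          using underS_total[OF card_of_Well_order, of p Q p'] UQ lt(2) by (auto simp: Field_card_of)
        then show ?thesis using IH pp' UQ unfolding ok_def by blast
      qed
      obtain x where x: "\<And>a. a \<in> insert c (f ` ?A) \<Longrightarrow> (a, x) \<in> R"
        "\<And>b. b \<in> insert d (f ` ?B) \<Longrightarrow> (x, b) \<in> R"
      proof (rule fills_gapsD[OF R(2)])
        show "|insert c (f ` ?A)| \<le>o \<kappa>" "|insert d (f ` ?B)| \<le>o \<kappa>" using small by auto
        show "(a, b) \<in> R" if "a \<in> insert c (f ` ?A)" "b \<in> insert d (f ` ?B)" for a b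
          using that cd between IH UQ unfolding ok_def by auto
      qed auto
      then show ?thesis unfolding ok_def by blast
    qed (simp add: ok_def)
  qed
  then obtain g where g: "\<And>q. ok g q (g q)" by blast
  have 1: "g x \<in> Field R" if "x \<in> Q" for x using g[of x] that by (auto simp: ok_def Field_def)
  have 2: "(g x, g y) \<in> R" if "x \<in> Q" "y \<in> Q" "lt x y" for x y
  proof -
    have "x \<in> underS ?W y \<or> y \<in> underS ?W x"
      using underS_total[OF card_of_Well_order, of x Q y] that lt(2) by (auto simp: Field_card_of)
    then show ?thesis using g[of x] g[of y] that unfolding ok_def by blast
  qed
  show thesis using that 1 2 by blast
qed

section \<open>Reindexing cuts\<close>

lemma has_cut_ordIso:
  assumes "has_cut R r r" "r =o r'"
  shows "has_cut R r' r'"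
proof -
  obtain f where f: "iso r' r f" and W: "Well_order r'" "Well_order r"
    using ordIso_symmetric[OF assms(2)] by (auto simp: ordIso_def)
  have bij: "bij_betw f (Field r') (Field r)" using f by (simp add: iso_def)
  have mono: "f x \<in> underS r (f y)" if "x \<in> underS r' y" for x y
  proof -
    have "embed r' r f" using f by (simp add: iso_def)
    then have "f ` underS r' y \<subseteq> underS r (f y)"
      using bij_betw_imp_surj_on[OF embed_underS[OF W(1) _ underS_in_Field(2)[OF that]]] by blast
    then show ?thesis using that by blast
  qed
  have img: "f ` Field r' = Field r" using bij by (simp add: bij_betw_def)
  obtain a b where ab: "cut_sequences R r a b" using assms(1) unfolding has_cut_iff by (elim exE)
  note D = cut_sequencesD[OF ab]
  have inF: "f i \<in> Field r" if "i \<in> Field r'" for i using img that by blast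
  have "cut_sequences R r' (a \<circ> f) (b \<circ> f)"
    unfolding cut_sequences_def
  proof (intro conjI)
    show "(a \<circ> f) ` Field r' \<subseteq> Field R" "(b \<circ> f) ` Field r' \<subseteq> Field R" using D(1,2) inF by auto
    show "\<forall>i' i. i' \<in> underS r' i \<longrightarrow> ((a \<circ> f) i', (a \<circ> f) i) \<in> R"
      "\<forall>i' i. i' \<in> underS r' i \<longrightarrow> ((b \<circ> f) i, (b \<circ> f) i') \<in> R"
      using D(3,4) mono by auto
    show "\<forall>i\<in>Field r'. \<forall>j\<in>Field r'. ((a \<circ> f) i, (b \<circ> f) j) \<in> R" using D(5) inF by auto
    show "\<not> (\<exists>x\<in>Field R. \<forall>i\<in>Field r'. \<forall>j\<in>Field r'. ((a \<circ> f) i, x) \<in> R \<and> (x, (b \<circ> f) j) \<in> R)"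
      using ab unfolding cut_sequences_def img[symmetric] by simp
  qed
  then show ?thesis unfolding has_cut_iff by (intro exI)
qed

text \<open>
  Without a \<open>(\<theta>, \<theta>)\<close>-cut, the nested intervals indexed by any subset of \<open>\<theta>\<close> of full size have a
  common point.
\<close>

lemma no_cut_subset:
  assumes "\<not> has_cut R r r" "Card_order r" "H \<subseteq> Field r" "|H| =o r" "infinite (Field r)" "trans R"
    and mono: "\<And>x y. x \<in> H \<Longrightarrow> y \<in> H \<Longrightarrow> x \<in> underS r y \<Longrightarrow>
      (a x, a y) \<in> R \<and> (a y, b y) \<in> R \<and> (b y, b x) \<in> R"
  obtains z where "z \<in> Field R" "\<And>x. x \<in> H \<Longrightarrow> (a x, z) \<in> R \<and> (z, b x) \<in> R"
proof -
  have W: "Well_order r" using assms(2) by (simp add: card_order_on_def)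
  have F: "Field (Restr r H) = H" by (rule Field_Restr_Well_order[OF W assms(3)])
  have "\<not> has_cut R (Restr r H) (Restr r H)"
    using assms(1) has_cut_ordIso Restr_large_ordIso[OF assms(2,3,4)] by blast
  moreover have up: "\<exists>y\<in>H. x \<in> underS r y \<and> x' \<in> underS r y" if xx': "x \<in> H" "x' \<in> H" for x x'
  proof -
    obtain u where u: "u \<in> Field r" "x \<in> underS r u" "x' \<in> underS r u"
      using Card_order_underS_upper[OF assms(2,5)] xx' assms(3) by blast
    obtain y where "y \<in> H" "u \<in> underS r y"
      using large_set_unbounded[OF assms(2,5,3,4) u(1)] by blast
    then show ?thesis using u underS_trans[OF W] by blast
  qed
  moreover have "a x \<in> Field R \<and> b x \<in> Field R" if "x \<in> H" for x
    using up[OF that that] mono that unfolding Field_def by blast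
  then have "a ` H \<subseteq> Field R" "b ` H \<subseteq> Field R" by auto
  moreover have "\<forall>i' i. i' \<in> underS (Restr r H) i \<longrightarrow> (a i', a i) \<in> R"
    "\<forall>i' i. i' \<in> underS (Restr r H) i \<longrightarrow> (b i, b i') \<in> R"
    using mono by (auto simp: underS_def)
  moreover have "(a i, b j) \<in> R" if ij: "i \<in> H" "j \<in> H" for i j
  proof -
    obtain y where "y \<in> H" "i \<in> underS r y" "j \<in> underS r y" using up ij by blast
    then show ?thesis using mono[of i y] mono[of j y] ij transD[OF assms(6)] by blast
  qed
  moreover have "\<not> cut_sequences R (Restr r H) a b"
    using calculation(1) unfolding has_cut_iff by blast
  ultimately have "\<exists>z\<in>Field R. \<forall>i\<in>H. \<forall>j\<in>H. (a i, z) \<in> R \<and> (z, b j) \<in> R"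
    unfolding cut_sequences_def F by simp
  then show thesis using that by blast
qed

section \<open>Normal measures\<close>

definition ultra :: "'i filter \<Rightarrow> bool" where
  "ultra F \<longleftrightarrow> F \<noteq> bot \<and> (\<forall>P. (\<forall>\<^sub>F i in F. P i) \<or> (\<forall>\<^sub>F i in F. \<not> P i))"

lemma ultra_not:
  assumes "ultra F"
  shows "(\<forall>\<^sub>F i in F. \<not> P i) \<longleftrightarrow> \<not> (\<forall>\<^sub>F i in F. P i)"
  using assms eventually_conj[of P F "\<lambda>i. \<not> P i"] unfolding ultra_def by auto

lemma ultra_ex:
  assumes "ultra F" "\<forall>\<^sub>F i in F. P i"
  shows "\<exists>i. P i"
  using assms unfolding ultra_def by (metis eventually_happens)

lemma eventually_choose:
  assumes "\<forall>\<^sub>F i in F. \<exists>y\<in>A. P i y"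
  obtains f where "\<forall>\<^sub>F i in F. f i \<in> A" "\<forall>\<^sub>F i in F. P i (f i)"
proof -
  define f where "f i = (SOME y. y \<in> A \<and> P i y)" for i
  have f: "\<forall>\<^sub>F i in F. f i \<in> A \<and> P i (f i)"
    using assms
  proof (rule eventually_mono)
    fix i assume "\<exists>y\<in>A. P i y"
    then show "f i \<in> A \<and> P i (f i)"
      unfolding f_def using someI_ex[of "\<lambda>y. y \<in> A \<and> P i y"] by blast
  qed
  show thesis by (rule that[of f]; rule eventually_mono[OF f]) simp_all
qed

text \<open>
  A filter makes ``for almost all \<open>i\<close>'' a quantifier, instead of a set of indices in \<open>D\<close>.
\<close>

definition ufilter :: "'i set \<Rightarrow> 'i set set \<Rightarrow> 'i filter" where
  "ufilter I D = Abs_filter (\<lambda>P. {i \<in> I. P i} \<in> D)"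

context
  fixes I :: "'i set" and D
  assumes D: "ultrafilter_on I D"
begin

lemma eventually_ufilter: "(\<forall>\<^sub>F i in ufilter I D. P i) \<longleftrightarrow> {i \<in> I. P i} \<in> D"
  unfolding ufilter_def
proof (rule eventually_Abs_filter, rule is_filter.intro)
  show "{i \<in> I. True} \<in> D" using D by (simp add: ultrafilter_on_def)
next
  fix P Q assume "{i \<in> I. P i} \<in> D" "{i \<in> I. Q i} \<in> D"
  moreover have "{i \<in> I. P i \<and> Q i} = {i \<in> I. P i} \<inter> {i \<in> I. Q i}" by auto
  ultimately show "{i \<in> I. P i \<and> Q i} \<in> D" using D by (simp add: ultrafilter_on_def)
next
  fix P Q assume "\<forall>x. P x \<longrightarrow> Q x" and P: "{i \<in> I. P i} \<in> D"
  then have "{i \<in> I. P i} \<subseteq> {i \<in> I. Q i}" "{i \<in> I. Q i} \<subseteq> I" by auto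
  then show "{i \<in> I. Q i} \<in> D" using D P unfolding ultrafilter_on_def by blast
qed

lemma eventually_ufilter_in: "\<forall>\<^sub>F i in ufilter I D. i \<in> I"
  using D by (simp add: eventually_ufilter ultrafilter_on_def)

lemma ultra_ufilter: "ultra (ufilter I D)"
  unfolding ultra_def
proof (intro conjI allI)
  show "ufilter I D \<noteq> bot"
    using eventually_ufilter[of "\<lambda>_. False"] D by (auto simp: ultrafilter_on_def)
  fix P
  have "{i \<in> I. \<not> P i} = I - {i \<in> I. P i}" by auto
  then show "(\<forall>\<^sub>F i in ufilter I D. P i) \<or> (\<forall>\<^sub>F i in ufilter I D. \<not> P i)"
    using D unfolding eventually_ufilter ultrafilter_on_def by simp
qed

end

locale normal_measure =
  fixes \<kappa> :: "'k rel" and E :: "'k set set"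
  assumes uncountable: "uncountable_cardinal \<kappa>"
    and ultrafilter: "ultrafilter_on (Field \<kappa>) E"
    and nonprincipal: "nonprincipal_on (Field \<kappa>) E"
    and complete: "complete_on (Field \<kappa>) \<kappa> E"
    and normal: "normal_on \<kappa> E"
begin

abbreviation F :: "'k filter" where "F \<equiv> ufilter (Field \<kappa>) E"

lemma Card: "Card_order \<kappa>" and wo: "Well_order \<kappa>" and inf: "infinite (Field \<kappa>)"
  and natLeq_less: "natLeq <o \<kappa>"
proof -
  show 1: "Card_order \<kappa>" "natLeq <o \<kappa>" using uncountable by (auto simp: uncountable_cardinal_def)
  then show "Well_order \<kappa>" by (simp add: card_order_on_def)
  show "infinite (Field \<kappa>)" using 1(2) by (rule infinite_Field_natLeq)
qed

lemmas eventually_F = eventually_ufilter[OF ultrafilter]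
lemmas F_in = eventually_ufilter_in[OF ultrafilter]
lemmas F_ultra = ultra_ufilter[OF ultrafilter]

lemma eventually_small_ball:
  assumes "|X| <o \<kappa>" "\<And>x. x \<in> X \<Longrightarrow> \<forall>\<^sub>F i in F. P x i"
  shows "\<forall>\<^sub>F i in F. \<forall>x\<in>X. P x i"
proof -
  let ?S = "(\<lambda>x. {i \<in> Field \<kappa>. P x i}) ` X"
  have "?S \<subseteq> E" using assms(2) by (auto simp: eventually_F)
  then have "Field \<kappa> \<inter> \<Inter> ?S \<in> E"
    using complete card_of_image_ordLess[OF assms(1)] unfolding complete_on_def by blast
  moreover have "Field \<kappa> \<inter> \<Inter> ?S = {i \<in> Field \<kappa>. \<forall>x\<in>X. P x i}" by auto
  ultimately show ?thesis by (simp add: eventually_F)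
qed

lemma eventually_neq: "\<forall>\<^sub>F i in F. i \<noteq> x"
proof (cases "x \<in> Field \<kappa>")
  case True
  then have "{i \<in> Field \<kappa>. i = x} = {x}" by auto
  then have "\<not> (\<forall>\<^sub>F i in F. i = x)"
    using nonprincipal True unfolding eventually_F nonprincipal_on_def by simp
  then show ?thesis by (simp add: ultra_not[OF F_ultra])
next
  case False
  then show ?thesis by (intro eventually_mono[OF F_in]) auto
qed

lemma eventually_not_in_small: "|X| <o \<kappa> \<Longrightarrow> \<forall>\<^sub>F i in F. i \<notin> X"
  using eventually_small_ball[of X "\<lambda>x i. i \<noteq> x"] eventually_neq by (auto elim: eventually_mono)

lemma measure_one_large:
  assumes "\<forall>\<^sub>F i in F. i \<in> H" "H \<subseteq> Field \<kappa>"
  shows "|H| =o \<kappa>"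
proof (rule not_ordLess_imp_ordIso[OF Card assms(2)], rule notI)
  assume "|H| <o \<kappa>"
  then have "\<forall>\<^sub>F i in F. i \<notin> H" by (rule eventually_not_in_small)
  then show False using assms(1) by (simp add: ultra_not[OF F_ultra])
qed

lemma eventually_above:
  assumes "x \<in> Field \<kappa>"
  shows "\<forall>\<^sub>F i in F. x \<in> underS \<kappa> i"
proof -
  obtain z where z: "z \<in> Field \<kappa>" "x \<in> underS \<kappa> z"
    using Card_order_underS_upper[OF Card inf assms assms] by blast
  have "\<forall>\<^sub>F i in F. i \<notin> underS \<kappa> z"
    using eventually_not_in_small[OF card_of_underS[OF Card z(1)]] .
  then show ?thesis
  proof (rule eventually_elim2[OF _ F_in])
    fix i assume "i \<notin> underS \<kappa> z" "i \<in> Field \<kappa>"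
    then show "x \<in> underS \<kappa> i" using underS_total[OF wo z(1), of i] z underS_trans[OF wo] by blast
  qed
qed

lemma eventually_diagonal:
  assumes "\<And>j. j \<in> Field \<kappa> \<Longrightarrow> \<forall>\<^sub>F i in F. P j i"
  shows "\<forall>\<^sub>F i in F. \<forall>j\<in>underS \<kappa> i. P j i"
proof -
  let ?A = "\<lambda>j. {i \<in> Field \<kappa>. P j i}"
  let ?X = "{i \<in> Field \<kappa>. \<forall>j\<in>underS \<kappa> (one_plus \<kappa> i). i \<in> ?A j}"
  have "\<forall>j\<in>Field \<kappa>. ?A j \<in> E" using assms by (simp add: eventually_F)
  then have "?X \<in> E" by (rule normal[unfolded normal_on_def, THEN spec[of _ ?A], THEN mp])
  moreover have "underS \<kappa> i \<subseteq> underS \<kappa> (one_plus \<kappa> i)" if i: "i \<in> Field \<kappa>" for i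
  proof (cases "finite (underS \<kappa> i)")
    case True
    have wo_rel: "wo_rel \<kappa>" using wo by (simp add: wo_rel_def)
    obtain z where "z \<in> Field \<kappa>" "i \<in> underS \<kappa> z"
      using Card_order_underS_upper[OF Card inf i i] by blast
    then have "AboveS \<kappa> {i} \<noteq> {}" by (auto simp: AboveS_def underS_def)
    then have "i \<in> underS \<kappa> (wo_rel.suc \<kappa> {i})"
      using wo_rel.suc_greater[OF wo_rel, of "{i}" i] i by (auto simp: underS_def)
    then show ?thesis using True underS_trans[OF wo] unfolding one_plus_def by auto
  qed (simp add: one_plus_def)
  then have "?X \<subseteq> {i \<in> Field \<kappa>. \<forall>j\<in>underS \<kappa> i. P j i}" by blast
  ultimately show ?thesis
    unfolding eventually_F using ultrafilter unfolding ultrafilter_on_def by blast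
qed

text \<open>
  For each \<open>x\<close> almost all pairs \<open>{x, y}\<close> have the same colour.  Almost all \<open>x\<close> agree
  on this colour, and by normality almost every \<open>y\<close> has a typical pair with each of its predecessors.
\<close>

lemma weakly_compact: "weakly_compact \<kappa>"
  unfolding weakly_compact_def arrows_pairs_def
proof (intro conjI ballI uncountable)
  fix c :: "'k set \<Rightarrow> nat" assume c: "c \<in> nsets (Field \<kappa>) 2 \<rightarrow> {..<2}"
  define P where "P x \<longleftrightarrow> (\<forall>\<^sub>F y in F. c {x, y} = 0)" for x
  obtain Q where Q: "\<forall>\<^sub>F x in F. P x = Q" 
  proof (cases "\<forall>\<^sub>F x in F. P x")
    case True
    then show thesis using that[of True] by simp
  next
    case False
    then have "\<forall>\<^sub>F x in F. \<not> P x" by (simp add: ultra_not[OF F_ultra])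
    then show thesis using that[of False] by simp
  qed
  define T where "T x y \<longleftrightarrow> (c {x, y} = 0) = P x" for x y
  have "\<forall>\<^sub>F y in F. T x y" for x
  proof (cases "P x")
    case True
    then show ?thesis by (simp add: T_def P_def)
  next
    case False
    then have "\<forall>\<^sub>F y in F. \<not> c {x, y} = 0"
      unfolding ultra_not[OF F_ultra] by (simp add: P_def)
    then show ?thesis using False by (simp add: T_def)
  qed
  then have diag: "\<forall>\<^sub>F y in F. \<forall>x\<in>underS \<kappa> y. T x y" by (intro eventually_diagonal)
  define H where "H = {y \<in> Field \<kappa>. P y = Q \<and> (\<forall>x\<in>underS \<kappa> y. T x y)}"
  have "\<forall>\<^sub>F y in F. y \<in> H" using F_in Q diag by eventually_elim (simp add: H_def)
  then have "|H| =o \<kappa>" using measure_one_large by (auto simp: H_def)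
  moreover have "H \<subseteq> Field \<kappa>" by (auto simp: H_def)
  moreover have "c ` nsets H 2 \<subseteq> {if Q then 0 else 1}"
  proof
    have *: "c {x, y} = (if Q then 0 else 1)" if "x \<in> H" "y \<in> H" "x \<in> underS \<kappa> y" for x y
    proof -
      have "x \<noteq> y" using that(3) underS_irrefl by metis
      then have "{x, y} \<in> nsets (Field \<kappa>) 2" using that(1,2) by (simp add: H_def nsets_def)
      then have "c {x, y} < 2" using c by (auto simp: Pi_iff)
      moreover have "T x y" "P x = Q" using that by (auto simp: H_def)
      ultimately show ?thesis by (auto simp: T_def)
    qed
    fix n assume "n \<in> c ` nsets H 2"
    then obtain x y where xy: "x \<in> H" "y \<in> H" "x \<noteq> y" "n = c {x, y}"
      by (auto simp: nsets_def card_2_iff)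
    then have "x \<in> underS \<kappa> y \<or> y \<in> underS \<kappa> x"
      using underS_total[OF wo, of x y] by (simp add: H_def)
    moreover have "{y, x} = {x, y}" by blast
    ultimately have "n = (if Q then 0 else 1)" using *[of x y] *[of y x] xy by auto
    then show "n \<in> {if Q then 0 else 1}" by simp
  qed
  ultimately show "\<exists>H \<xi>. H \<subseteq> Field \<kappa> \<and> |H| =o \<kappa> \<and> \<xi> < 2 \<and> c ` nsets H 2 \<subseteq> {\<xi>}"
    by (intro exI[of _ H] exI[of _ "if Q then 0 else 1"]) auto
qed

end

section \<open>Ultrapowers of linear orders\<close>

text \<open>
  \<open>S\<close> is the ultrapower of the order \<open>R\<close> by \<open>F\<close>, and \<open>rep x\<close> is a chosen function that represents
  the point \<open>x\<close>.  The conditions determine \<open>S\<close> only up to isomorphism, so they hold for any isomorphic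
  copy of the quotient.
\<close>

locale order_ultrapower =
  fixes R :: "'m rel" and S :: "'n rel" and F :: "'i filter" and rep :: "'n \<Rightarrow> 'i \<Rightarrow> 'm"
  assumes ultra: "ultra F"
    and rep_Field: "x \<in> Field S \<Longrightarrow> \<forall>\<^sub>F i in F. rep x i \<in> Field R"
    and represented: "\<forall>\<^sub>F i in F. f i \<in> Field R \<Longrightarrow> \<exists>x\<in>Field S. \<forall>\<^sub>F i in F. rep x i = f i"
    and rep_less: "x \<in> Field S \<Longrightarrow> y \<in> Field S \<Longrightarrow> (x, y) \<in> S \<longleftrightarrow> (\<forall>\<^sub>F i in F. (rep x i, rep y i) \<in> R)"
    and rep_inject: "x \<in> Field S \<Longrightarrow> y \<in> Field S \<Longrightarrow> \<forall>\<^sub>F i in F. rep x i = rep y i \<Longrightarrow> x = y"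
    and dense: "dense_linear_order R"
begin

lemma choose_point:
  assumes "\<forall>\<^sub>F i in F. \<exists>y\<in>Field R. P i y"
  obtains x where "x \<in> Field S" "\<forall>\<^sub>F i in F. P i (rep x i)"
proof -
  obtain f where f: "\<forall>\<^sub>F i in F. f i \<in> Field R" "\<forall>\<^sub>F i in F. P i (f i)"
    by (rule eventually_choose[OF assms])
  from represented[OF f(1)]
  obtain x where x: "x \<in> Field S" "\<forall>\<^sub>F i in F. rep x i = f i" by (elim bexE)
  have "\<forall>\<^sub>F i in F. P i (rep x i)" using f(2) x(2) by eventually_elim simp
  then show thesis using that x(1) by blast
qed

lemma S_Field: "(x, y) \<in> S \<Longrightarrow> x \<in> Field S \<and> y \<in> Field S"
  by (auto simp: Field_def)

lemma S_less: "(x, y) \<in> S \<Longrightarrow> \<forall>\<^sub>F i in F. (rep x i, rep y i) \<in> R"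
  using rep_less S_Field by blast

lemmas R_trans = transD[OF dense_linear_orderD(1)[OF dense]]

lemma R_irrefl: "(x, x) \<notin> R"
  using dense_linear_orderD(2)[OF dense] by (simp add: irrefl_def)

lemma S_trans: "trans S"
proof (rule transI)
  fix x y z assume xyz: "(x, y) \<in> S" "(y, z) \<in> S"
  have "\<forall>\<^sub>F i in F. (rep x i, rep z i) \<in> R"
    using S_less[OF xyz(1)] S_less[OF xyz(2)] by eventually_elim (rule R_trans)
  then show "(x, z) \<in> S" using rep_less S_Field[OF xyz(1)] S_Field[OF xyz(2)] by simp
qed

lemma S_dense_linear_order: "dense_linear_order S"
  unfolding dense_linear_order_def strict_linear_order_on_def
proof (intro conjI allI impI S_trans)
  show "irrefl S"
  proof (rule irreflI)
    fix x show "(x, x) \<notin> S"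
    proof
      assume "(x, x) \<in> S"
      then have "\<forall>\<^sub>F i in F. (rep x i, rep x i) \<in> R" by (rule S_less)
      then show False using ultra_ex[OF ultra] R_irrefl by blast
    qed
  qed
  show "total_on (Field S) S"
  proof (rule total_onI)
    fix x y assume xy: "x \<in> Field S" "y \<in> Field S" "x \<noteq> y"
    have 1: "\<not> (\<forall>\<^sub>F i in F. rep x i = rep y i)" using rep_inject xy by blast
    show "(x, y) \<in> S \<or> (y, x) \<in> S"
    proof (rule ccontr)
      assume 2: "\<not> ((x, y) \<in> S \<or> (y, x) \<in> S)"
      have "\<forall>\<^sub>F i in F. \<not> rep x i = rep y i" "\<forall>\<^sub>F i in F. \<not> (rep x i, rep y i) \<in> R"
        "\<forall>\<^sub>F i in F. \<not> (rep y i, rep x i) \<in> R"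
        unfolding ultra_not[OF ultra] using 1 2 rep_less xy(1,2) by simp_all
      then have "\<forall>\<^sub>F i in F. False"
        using rep_Field[OF xy(1)] rep_Field[OF xy(2)]
        by eventually_elim (use dense_linear_orderD(3)[OF dense] in \<open>auto simp: total_on_def\<close>)
      then show False using ultra_ex[OF ultra] by blast
    qed
  qed
  obtain c d where cd: "(c, d) \<in> R" using dense_linear_orderD(4)[OF dense] by auto
  then have "c \<in> Field R" "d \<in> Field R" unfolding Field_def by auto
  then have c: "\<forall>\<^sub>F i in F. \<exists>y\<in>Field R. y = c" and d: "\<forall>\<^sub>F i in F. \<exists>y\<in>Field R. y = d"
    by simp_all
  obtain x where x: "x \<in> Field S" "\<forall>\<^sub>F i in F. rep x i = c" by (rule choose_point[OF c])
  obtain y where y: "y \<in> Field S" "\<forall>\<^sub>F i in F. rep y i = d" by (rule choose_point[OF d])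
  have "\<forall>\<^sub>F i in F. (rep x i, rep y i) \<in> R" using x(2) y(2) by eventually_elim (simp add: cd)
  then show "S \<noteq> {}" using rep_less x(1) y(1) by blast
  fix x y assume xy: "(x, y) \<in> S"
  have ev: "\<forall>\<^sub>F i in F. \<exists>z\<in>Field R. (rep x i, z) \<in> R \<and> (z, rep y i) \<in> R"
    using S_less[OF xy] by eventually_elim (use dense_linear_orderD(5)[OF dense] in \<open>force simp: Field_def\<close>)
  obtain z where z: "z \<in> Field S" "\<forall>\<^sub>F i in F. (rep x i, rep z i) \<in> R \<and> (rep z i, rep y i) \<in> R"
    by (rule choose_point[OF ev])
  have "(x, z) \<in> S" "(z, y) \<in> S"
    using z rep_less S_Field[OF xy] by (auto elim: eventually_mono)
  then show "\<exists>z. (x, z) \<in> S \<and> (z, y) \<in> S" by blast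
qed

text \<open>
  The cut of \<open>R\<close> is mapped to constant functions.  At each coordinate, some stage of the cut
  excludes a function that fills it, and by regularity one stage serves for all coordinates.
\<close>

lemma cut_preserved:
  assumes cut: "has_cut R r r"
    and r: "Card_order r" "infinite (Field r)" "regularCard r"
    and I: "\<forall>\<^sub>F i in F. i \<in> I" "|I| <o r"
  shows "has_cut S r r"
proof -
  obtain a b where ab: "cut_sequences R r a b" using cut unfolding has_cut_iff by (elim exE)
  note D = cut_sequencesD[OF ab]
  have const: "\<exists>x\<in>Field S. \<forall>\<^sub>F i in F. rep x i = y" if "y \<in> Field R" for y
    using represented[of "\<lambda>_. y"] that by simp
  have "\<forall>j\<in>Field r. \<exists>x. x \<in> Field S \<and> (\<forall>\<^sub>F i in F. rep x i = a j)" using const D(1) by blast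
  then obtain A where A: "\<And>j. j \<in> Field r \<Longrightarrow> A j \<in> Field S"
    "\<And>j. j \<in> Field r \<Longrightarrow> \<forall>\<^sub>F i in F. rep (A j) i = a j" by metis
  have "\<forall>j\<in>Field r. \<exists>x. x \<in> Field S \<and> (\<forall>\<^sub>F i in F. rep x i = b j)" using const D(2) by blast
  then obtain B where B: "\<And>j. j \<in> Field r \<Longrightarrow> B j \<in> Field S"
    "\<And>j. j \<in> Field r \<Longrightarrow> \<forall>\<^sub>F i in F. rep (B j) i = b j" by metis
  have "cut_sequences S r A B"
    unfolding cut_sequences_def
  proof (intro conjI allI impI ballI)
    show "A ` Field r \<subseteq> Field S" "B ` Field r \<subseteq> Field S" using A(1) B(1) by auto
    show "(A i, A j) \<in> S" "(B j, B i) \<in> S" if ij: "i \<in> underS r j" for i j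
    proof -
      note F = underS_in_Field[OF ij]
      have "\<forall>\<^sub>F k in F. (rep (A i) k, rep (A j) k) \<in> R"
        using A(2)[OF F(1)] A(2)[OF F(2)] by eventually_elim (simp add: D(3)[OF ij])
      moreover have "\<forall>\<^sub>F k in F. (rep (B j) k, rep (B i) k) \<in> R"
        using B(2)[OF F(1)] B(2)[OF F(2)] by eventually_elim (simp add: D(4)[OF ij])
      ultimately show "(A i, A j) \<in> S" "(B j, B i) \<in> S" using rep_less A(1) B(1) F by simp_all
    qed
    show "(A i, B j) \<in> S" if ij: "i \<in> Field r" "j \<in> Field r" for i j
    proof -
      have "\<forall>\<^sub>F k in F. (rep (A i) k, rep (B j) k) \<in> R"
        using A(2)[OF ij(1)] B(2)[OF ij(2)] by eventually_elim (simp add: D(5)[OF ij])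
      then show ?thesis using rep_less A(1) B(1) ij by simp
    qed
    show "\<not> (\<exists>x\<in>Field S. \<forall>i\<in>Field r. \<forall>j\<in>Field r. (A i, x) \<in> S \<and> (x, B j) \<in> S)"
    proof
      assume "\<exists>x\<in>Field S. \<forall>i\<in>Field r. \<forall>j\<in>Field r. (A i, x) \<in> S \<and> (x, B j) \<in> S"
      then obtain x where x: "x \<in> Field S"
        and fill: "\<And>i. i \<in> Field r \<Longrightarrow> (A i, x) \<in> S \<and> (x, B i) \<in> S" by blast
      have "\<exists>j\<in>Field r. rep x i \<in> Field R \<longrightarrow> (a j, rep x i) \<notin> R \<or> (rep x i, b j) \<notin> R" for i
      proof (cases "rep x i \<in> Field R")
        case True
        obtain j k where jk: "j \<in> Field r" "k \<in> Field r" "(a j, rep x i) \<notin> R \<or> (rep x i, b k) \<notin> R"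
          by (rule cut_sequences_unfilled[OF ab True])
        obtain m where m: "m \<in> Field r" "j \<in> underS r m" "k \<in> underS r m"
          by (rule Card_order_underS_upper[OF r(1,2) jk(1,2)])
        have "(a m, rep x i) \<notin> R \<or> (rep x i, b m) \<notin> R"
          using jk(3) D(3)[OF m(2)] D(4)[OF m(3)] R_trans by blast
        then show ?thesis using m(1) by blast
      qed (use r(2) in \<open>auto intro: infinite_imp_nonempty[THEN ex_in_conv[THEN iffD2]]\<close>)
      then obtain \<xi> where \<xi>: "\<And>i. \<xi> i \<in> Field r"
        "\<And>i. rep x i \<in> Field R \<Longrightarrow> (a (\<xi> i), rep x i) \<notin> R \<or> (rep x i, b (\<xi> i)) \<notin> R" by metis
      have "\<xi> ` I \<subseteq> Field r" using \<xi>(1) by blast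
      then obtain \<beta> where \<beta>: "\<beta> \<in> Field r" "\<xi> ` I \<subseteq> underS r \<beta>"
        by (rule regularCard_bounded[OF r]) (rule card_of_image_ordLess[OF I(2)])
      have "\<forall>\<^sub>F i in F. False"
        using rep_Field[OF x] S_less[OF conjunct1[OF fill[OF \<beta>(1)]]] S_less[OF conjunct2[OF fill[OF \<beta>(1)]]]
          A(2)[OF \<beta>(1)] B(2)[OF \<beta>(1)] I(1)
      proof eventually_elim
        case (elim i)
        then have "\<xi> i \<in> underS r \<beta>" using \<beta>(2) by blast
        then show ?case using \<xi>(2)[of i] D(3,4)[of "\<xi> i" \<beta>] elim R_trans by metis
      qed
      then show False using ultra_ex[OF ultra] by blast
    qed
  qed
  then show ?thesis unfolding has_cut_iff by (intro exI)
qed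

end

context order_ultrapower
begin

text \<open>
  For a cut \<open>(a, b)\<close> of \<open>S\<close> the assertion that the intervals of \<open>\<xi>\<close> and \<open>\<gamma>\<close> are properly nested
  at coordinate \<open>i\<close> can depend on \<open>\<gamma>\<close>.  On a suitable large set of indices it stabilizes for all
  \<open>\<xi>\<close> and \<open>i\<close>, and then it holds for all later \<open>\<gamma>\<close> or for none.  At almost every coordinate
  \<open>i\<close> this leaves a nested sequence of length \<open>\<theta>\<close>, which has a common point in \<open>R\<close>.  These points
  represent a point in the gap of \<open>S\<close>.
\<close>

lemma weakly_compact_no_cut:
  assumes \<theta>: "weakly_compact \<theta>"
    and I: "\<forall>\<^sub>F i in F. i \<in> I" "|I| <o \<theta>"
    and no_cut: "\<not> has_cut R \<theta> \<theta>"
  shows "\<not> has_cut S \<theta> \<theta>"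
proof
  interpret weakly_compact_cardinal \<theta> using \<theta> by unfold_locales
  assume "has_cut S \<theta> \<theta>"
  then obtain a b where ab: "cut_sequences S \<theta> a b" unfolding has_cut_iff by (elim exE)
  note D = cut_sequencesD[OF ab]
  define nested where "nested \<gamma> p \<longleftrightarrow> (case p of (\<xi>, i) \<Rightarrow>
    (rep (a \<xi>) i, rep (a \<gamma>) i) \<in> R \<and> (rep (a \<gamma>) i, rep (b \<gamma>) i) \<in> R \<and> (rep (b \<gamma>) i, rep (b \<xi>) i) \<in> R)"
    for \<gamma> p
  have ev_nested: "\<forall>\<^sub>F i in F. nested \<gamma> (\<xi>, i)" if "\<xi> \<in> underS \<theta> \<gamma>" for \<xi> \<gamma>
  proof -
    have "\<gamma> \<in> Field \<theta>" using underS_in_Field[OF that] by simp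
    from S_less[OF D(3)[OF that]] S_less[OF D(5)[OF this this]] S_less[OF D(4)[OF that]]
    show ?thesis by eventually_elim (simp add: nested_def)
  qed
  have "|Field \<theta> \<times> I| \<le>o \<theta>"
    using card_of_Times_ordLeq_infinite_Field[OF inf _ ordLess_imp_ordLeq[OF I(2)] Card]
      ordIso_imp_ordLeq[OF card_of_Field_ordIso[OF Card]] by blast
  then obtain H where H: "H \<subseteq> Field \<theta>" "|H| =o \<theta>"
    and stable: "\<forall>p\<in>Field \<theta> \<times> I. \<exists>\<beta>\<in>Field \<theta>. \<forall>x\<in>H. \<forall>y\<in>H.
      \<beta> \<in> underS \<theta> x \<longrightarrow> \<beta> \<in> underS \<theta> y \<longrightarrow> nested x p = nested y p"
    by (rule stabilizing_subset[where s = nested])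
  define stab where "stab p \<beta> \<longleftrightarrow> \<beta> \<in> Field \<theta> \<and>
    (\<forall>x\<in>H. \<forall>y\<in>H. \<beta> \<in> underS \<theta> x \<longrightarrow> \<beta> \<in> underS \<theta> y \<longrightarrow> nested x p = nested y p)" for p \<beta>
  have stab_mono: "stab p \<delta>" if "stab p \<beta>" "\<beta> \<in> underS \<theta> \<delta>" for p \<beta> \<delta>
    using that underS_trans[OF wo that(2)] underS_in_Field[OF that(2)] unfolding stab_def by blast
  have "\<exists>\<beta>. \<forall>i\<in>I. stab (\<xi>, i) \<beta>" if \<xi>: "\<xi> \<in> Field \<theta>" for \<xi>
  proof -
    have "\<forall>i\<in>I. \<exists>\<beta>. stab (\<xi>, i) \<beta>" using stable \<xi> unfolding stab_def Bex_def by blast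
    then obtain \<beta> where \<beta>: "\<And>i. i \<in> I \<Longrightarrow> stab (\<xi>, i) (\<beta> i)" by metis
    have "\<beta> ` I \<subseteq> Field \<theta>" using \<beta> by (auto simp: stab_def)
    then obtain \<delta> where \<delta>: "\<delta> \<in> Field \<theta>" "\<beta> ` I \<subseteq> underS \<theta> \<delta>"
      by (rule bounded) (rule card_of_image_ordLess[OF I(2)])
    then have "stab (\<xi>, i) \<delta>" if "i \<in> I" for i using stab_mono[OF \<beta>[OF that]] that by blast
    then show ?thesis by blast
  qed
  then obtain \<delta> where \<delta>: "\<And>\<xi> i. \<xi> \<in> Field \<theta> \<Longrightarrow> i \<in> I \<Longrightarrow> stab (\<xi>, i) (\<delta> \<xi>)" by metis
  obtain i where "i \<in> I" using ultra_ex[OF ultra I(1)] by blast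
  then have \<delta>F: "\<delta> \<xi> \<in> Field \<theta>" if "\<xi> \<in> Field \<theta>" for \<xi>
    using \<delta>[OF that] by (simp add: stab_def)
  \<comment> \<open>Thin out the index set so that each of its members lies beyond the stage at which its
    predecessors stabilize.\<close>
  obtain K where K: "K \<subseteq> H" "|K| =o \<theta>"
    "(\<forall>x\<in>K. \<forall>y\<in>K. x \<in> underS \<theta> y \<longrightarrow> \<delta> x \<in> underS \<theta> y) \<or>
     (\<forall>x\<in>K. \<forall>y\<in>K. x \<in> underS \<theta> y \<longrightarrow> \<not> \<delta> x \<in> underS \<theta> y)"
    by (rule homogeneous_set[OF H])
  have KF: "K \<subseteq> Field \<theta>" using K(1) H(1) by blast
  have above: "\<exists>y\<in>K. x \<in> underS \<theta> y" if "x \<in> Field \<theta>" for x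
    using unbounded[OF KF K(2) that] by blast
  have \<delta>K: "\<delta> x \<in> underS \<theta> y" if xy: "x \<in> K" "y \<in> K" "x \<in> underS \<theta> y" for x y
  proof (rule ccontr)
    assume "\<delta> x \<notin> underS \<theta> y"
    then have *: "\<forall>x\<in>K. \<forall>y\<in>K. x \<in> underS \<theta> y \<longrightarrow> \<not> \<delta> x \<in> underS \<theta> y" using K(3) xy by blast
    have x: "x \<in> Field \<theta>" using xy(1) KF by blast
    obtain z where z: "z \<in> Field \<theta>" "x \<in> underS \<theta> z" "\<delta> x \<in> underS \<theta> z" by (rule upper[OF x \<delta>F[OF x]])
    obtain w where w: "w \<in> K" "z \<in> underS \<theta> w" using above[OF z(1)] by blast
    have "x \<in> underS \<theta> w" "\<delta> x \<in> underS \<theta> w" using z w underS_trans[OF wo] by blast+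
    then show False using * xy(1) w(1) by blast
  qed
  define X where "X i = {\<xi> \<in> K. \<exists>\<gamma>\<in>K. \<xi> \<in> underS \<theta> \<gamma> \<and> nested \<gamma> (\<xi>, i)}" for i
  have XK: "X i \<subseteq> K" and XF: "X i \<subseteq> Field \<theta>" for i using KF by (auto simp: X_def)
  have X_nested: "nested \<gamma> (\<xi>, i)" if X: "\<xi> \<in> X i" "\<gamma> \<in> K" "\<xi> \<in> underS \<theta> \<gamma>" "i \<in> I" for \<xi> \<gamma> i
  proof -
    obtain \<gamma>' where \<gamma>': "\<gamma>' \<in> K" "\<xi> \<in> underS \<theta> \<gamma>'" "nested \<gamma>' (\<xi>, i)" and \<xi>: "\<xi> \<in> K"
      using X(1) by (auto simp: X_def)
    have "stab (\<xi>, i) (\<delta> \<xi>)" using \<delta> X(4) \<xi> KF by blast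
    moreover have "\<gamma> \<in> H" "\<gamma>' \<in> H" "\<delta> \<xi> \<in> underS \<theta> \<gamma>" "\<delta> \<xi> \<in> underS \<theta> \<gamma>'"
      using K(1) \<delta>K \<xi> X(2,3) \<gamma>'(1,2) by auto
    ultimately have "nested \<gamma> (\<xi>, i) = nested \<gamma>' (\<xi>, i)" unfolding stab_def by blast
    then show ?thesis using \<gamma>'(3) by simp
  qed
  have ev_X: "\<forall>\<^sub>F i in F. \<xi> \<in> X i" if \<xi>: "\<xi> \<in> K" for \<xi>
  proof -
    have "\<xi> \<in> Field \<theta>" using \<xi> KF by blast
    then obtain \<gamma> where \<gamma>: "\<gamma> \<in> K" "\<xi> \<in> underS \<theta> \<gamma>" using above by blast
    show ?thesis using ev_nested[OF \<gamma>(2)] by eventually_elim (use \<xi> \<gamma> in \<open>auto simp: X_def\<close>)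
  qed
  define J where "J = {i \<in> I. |X i| =o \<theta>}"
  have ev_J: "\<forall>\<^sub>F i in F. i \<in> J"
  proof -
    have "\<forall>i\<in>I - J. \<exists>z. z \<in> Field \<theta> \<and> X i \<subseteq> underS \<theta> z"
    proof
      fix i assume "i \<in> I - J"
      then have "|X i| <o \<theta>" using not_ordLess_imp_ordIso[OF Card XF] by (auto simp: J_def)
      then show "\<exists>z. z \<in> Field \<theta> \<and> X i \<subseteq> underS \<theta> z" using bounded[OF XF] by metis
    qed
    from bchoice[OF this] obtain \<epsilon> where \<epsilon>: "\<And>i. i \<in> I - J \<Longrightarrow> \<epsilon> i \<in> Field \<theta> \<and> X i \<subseteq> underS \<theta> (\<epsilon> i)"
      by auto
    have "\<epsilon> ` (I - J) \<subseteq> Field \<theta>" using \<epsilon> by blast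
    then obtain z where z: "z \<in> Field \<theta>" "\<epsilon> ` (I - J) \<subseteq> underS \<theta> z"
      by (rule bounded) (rule card_of_image_ordLess[OF card_of_subset_ordLess[OF I(2) Diff_subset]])
    obtain \<xi> where \<xi>: "\<xi> \<in> K" "z \<in> underS \<theta> \<xi>" using above[OF z(1)] by blast
    show ?thesis using ev_X[OF \<xi>(1)] I(1)
    proof eventually_elim
      case (elim i)
      show "i \<in> J"
      proof (rule ccontr)
        assume "i \<notin> J"
        then have "\<epsilon> i \<in> underS \<theta> z" "\<xi> \<in> underS \<theta> (\<epsilon> i)" using elim \<epsilon>[of i] z(2) by blast+
        then have "\<xi> \<in> underS \<theta> z" using underS_trans[OF wo] by blast
        then show False using underS_asym[OF wo \<xi>(2)] by blast
      qed
    qed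
  qed
  have "\<forall>\<^sub>F i in F. \<exists>y\<in>Field R. \<forall>\<xi>\<in>X i. (rep (a \<xi>) i, y) \<in> R \<and> (y, rep (b \<xi>) i) \<in> R"
    using ev_J
  proof (rule eventually_mono)
    fix i assume i: "i \<in> J"
    show "\<exists>y\<in>Field R. \<forall>\<xi>\<in>X i. (rep (a \<xi>) i, y) \<in> R \<and> (y, rep (b \<xi>) i) \<in> R"
    proof (rule no_cut_subset[OF no_cut Card XF[of i] _ inf dense_linear_orderD(1)[OF dense]])
      show "|X i| =o \<theta>" using i by (simp add: J_def)
      show "(rep (a \<xi>) i, rep (a \<gamma>) i) \<in> R \<and> (rep (a \<gamma>) i, rep (b \<gamma>) i) \<in> R \<and> (rep (b \<gamma>) i, rep (b \<xi>) i) \<in> R"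
        if "\<xi> \<in> X i" "\<gamma> \<in> X i" "\<xi> \<in> underS \<theta> \<gamma>" for \<xi> \<gamma>
        using X_nested[of \<xi> i \<gamma>] that XK i by (auto simp: J_def nested_def)
    qed blast
  qed
  then obtain x where x: "x \<in> Field S"
    "\<forall>\<^sub>F i in F. \<forall>\<xi>\<in>X i. (rep (a \<xi>) i, rep x i) \<in> R \<and> (rep x i, rep (b \<xi>) i) \<in> R"
    by (rule choose_point)
  have fill: "(a \<xi>, x) \<in> S \<and> (x, b \<xi>) \<in> S" if \<xi>: "\<xi> \<in> Field \<theta>" for \<xi>
  proof -
    obtain \<gamma> where \<gamma>: "\<gamma> \<in> K" "\<xi> \<in> underS \<theta> \<gamma>" using above[OF \<xi>] by blast
    have "\<forall>\<^sub>F i in F. (rep (a \<gamma>) i, rep x i) \<in> R" "\<forall>\<^sub>F i in F. (rep x i, rep (b \<gamma>) i) \<in> R"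
      using x(2) ev_X[OF \<gamma>(1)] by (eventually_elim, blast)+
    moreover have "\<gamma> \<in> Field \<theta>" using \<gamma>(1) KF by blast
    ultimately have "(a \<gamma>, x) \<in> S" "(x, b \<gamma>) \<in> S" using rep_less D(1,2) x(1) by simp_all
    then show ?thesis using D(3,4)[OF \<gamma>(2)] transD[OF S_trans] by blast
  qed
  obtain i j where "i \<in> Field \<theta>" "j \<in> Field \<theta>" "(a i, x) \<notin> S \<or> (x, b j) \<notin> S"
    by (rule cut_sequences_unfilled[OF ab x(1)])
  then show False using fill by blast
qed

end

locale normal_order_ultrapower =
  normal_measure \<kappa> E + order_ultrapower R S "ufilter (Field \<kappa>) E" rep
  for \<kappa> :: "'k rel" and E and R :: "'m rel" and S :: "'n rel" and rep
begin

text \<open>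
  By normality, at almost every coordinate \<open>i\<close> all inequalities between terms of index below \<open>i\<close> hold,
  and these are few terms.
\<close>

lemma no_cut_at_measure:
  assumes fills: "fills_gaps R \<kappa>"
  shows "\<not> has_cut S \<kappa> \<kappa>"
proof
  assume "has_cut S \<kappa> \<kappa>"
  then obtain a b where ab: "cut_sequences S \<kappa> a b" unfolding has_cut_iff by (elim exE)
  note D = cut_sequencesD[OF ab]
  obtain z where z: "z \<in> Field \<kappa>" using inf by fastforce
  have "\<forall>\<^sub>F i in F. \<forall>j\<in>underS \<kappa> i. \<forall>k\<in>underS \<kappa> i. (rep (a j) i, rep (b k) i) \<in> R"
    using S_less[OF D(5)] by (intro eventually_diagonal)
  then have "\<forall>\<^sub>F i in F. \<exists>y\<in>Field R. \<forall>j\<in>underS \<kappa> i. (rep (a j) i, y) \<in> R \<and> (y, rep (b j) i) \<in> R"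
    using eventually_above[OF z] F_in
  proof eventually_elim
    case (elim i)
    have "|underS \<kappa> i| \<le>o \<kappa>" using ordLess_imp_ordLeq[OF card_of_underS[OF Card elim(3)]] .
    then have small: "|f ` underS \<kappa> i| \<le>o \<kappa>" for f :: "_ \<Rightarrow> 'm"
      by (rule ordLeq_transitive[OF card_of_image])
    obtain y where y: "y \<in> Field R" "\<And>u. u \<in> (\<lambda>j. rep (a j) i) ` underS \<kappa> i \<Longrightarrow> (u, y) \<in> R"
      "\<And>u. u \<in> (\<lambda>j. rep (b j) i) ` underS \<kappa> i \<Longrightarrow> (y, u) \<in> R"
      by (rule fills_gapsD[OF fills _ _ small small, of "\<lambda>j. rep (a j) i" "\<lambda>j. rep (b j) i"])
        (use elim in auto)
    show ?case by (rule bexI[OF _ y(1)]) (use y(2,3) in auto)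
  qed
  then obtain x where x: "x \<in> Field S"
    "\<forall>\<^sub>F i in F. \<forall>j\<in>underS \<kappa> i. (rep (a j) i, rep x i) \<in> R \<and> (rep x i, rep (b j) i) \<in> R"
    by (rule choose_point)
  have fill: "(a j, x) \<in> S \<and> (x, b j) \<in> S" if j: "j \<in> Field \<kappa>" for j
  proof -
    have "\<forall>\<^sub>F i in F. (rep (a j) i, rep x i) \<in> R" "\<forall>\<^sub>F i in F. (rep x i, rep (b j) i) \<in> R"
      using x(2) eventually_above[OF j] by (eventually_elim, blast)+
    then show ?thesis using rep_less D(1,2)[OF j] x(1) by simp
  qed
  obtain i j where "i \<in> Field \<kappa>" "j \<in> Field \<kappa>" "(a i, x) \<notin> S \<or> (x, b j) \<notin> S"
    by (rule cut_sequences_unfilled[OF ab x(1)])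
  then show False using fill by blast
qed

end

section \<open>A cut of cofinality \<open>\<kappa>\<^sup>+\<close> from a normal measure\<close>

context normal_order_ultrapower
begin

text \<open>
  By normality, almost every \<open>i < \<kappa>\<close> is closed under the partial function on \<open>\<kappa>\<close> that maps \<open>f z\<close> to
  \<open>g z\<close>, and under its inverse.
\<close>

lemma eventually_same_initial_part:
  assumes "inj_on f Z" "f ` Z \<subseteq> Field \<kappa>" "inj_on g Z" "g ` Z \<subseteq> Field \<kappa>"
  shows "\<forall>\<^sub>F i in F. \<forall>z\<in>Z. f z \<in> underS \<kappa> i \<longleftrightarrow> g z \<in> underS \<kappa> i"
proof -
  have half: "\<forall>\<^sub>F i in F. \<forall>z\<in>Z. f z \<in> underS \<kappa> i \<longrightarrow> g z \<in> underS \<kappa> i"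
    if fg: "inj_on f Z" "f ` Z \<subseteq> Field \<kappa>" "g ` Z \<subseteq> Field \<kappa>" for f g :: "'z \<Rightarrow> 'k" and Z
  proof -
    have "\<forall>\<^sub>F i in F. \<forall>z\<in>Z. f z = j \<longrightarrow> g z \<in> underS \<kappa> i" for j
    proof (cases "\<exists>z\<in>Z. f z = j")
      case True
      then obtain z where z: "z \<in> Z" "f z = j" by blast
      have "g z \<in> Field \<kappa>" using fg(3) z(1) by blast
      from eventually_above[OF this] show ?thesis
        by (rule eventually_mono) (use z fg(1) in \<open>auto simp: inj_on_def\<close>)
    qed auto
    then have "\<forall>\<^sub>F i in F. \<forall>j\<in>underS \<kappa> i. \<forall>z\<in>Z. f z = j \<longrightarrow> g z \<in> underS \<kappa> i"
      by (intro eventually_diagonal)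
    then show ?thesis by (rule eventually_mono) blast
  qed
  show ?thesis
    using half[OF assms(1,2,4)] half[OF assms(3,4,2)] by eventually_elim blast
qed

text \<open>
  Choose injections \<open>e \<alpha>\<close> of all \<open>\<alpha> < \<kappa>\<^sup>+\<close> into \<open>\<kappa>\<close>.  The set \<open>u \<alpha> i = {\<gamma> < \<alpha>. e \<alpha> \<gamma> < i}\<close> has size
  below \<open>\<kappa>\<close>, and for \<open>\<alpha> < \<beta>\<close> normality gives \<open>u \<alpha> i = u \<beta> i \<inter> \<alpha>\<close> for almost all \<open>i\<close>.  The
  functions \<open>lo \<alpha> i\<close> and \<open>hi \<alpha> i\<close> bound the lexicographic interval of all functions that extend the
  characteristic function of \<open>u \<alpha> i\<close> on \<open>\<alpha>\<close>.  The \<open>\<kappa>\<^sup>+\<close> many end points embed into \<open>R\<close>, so the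
  intervals of \<open>\<alpha> < \<kappa>\<^sup>+\<close> are nested in \<open>S\<close>.  A point \<open>x\<close> in all of them determines at each
  coordinate \<open>i\<close> a chain of sets \<open>u \<alpha> i\<close> under end extension.  Its union \<open>B i\<close> has
  size at most \<open>\<kappa>\<close>, because its proper initial segments have size below \<open>\<kappa>\<close>.  So all \<open>B i\<close> together
  are bounded in \<open>\<kappa>\<^sup>+\<close>, but each element of \<open>\<kappa>\<^sup>+\<close> lies in \<open>B i\<close> for almost all \<open>i\<close>.
\<close>

lemma cut_at_cardSuc:
  assumes fills: "fills_gaps R \<kappa>"
  shows "has_cut S (cardSuc \<kappa>) (cardSuc \<kappa>)"
proof -
  let ?K = "cardSuc \<kappa>"
  have K: "Card_order ?K" "Well_order ?K" "infinite (Field ?K)"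
    using cardSuc_Card_order[OF Card] cardSuc_finite[OF Card] inf by (auto simp: card_order_on_def)
  have "\<exists>f. inj_on f (underS ?K \<alpha>) \<and> f ` underS ?K \<alpha> \<subseteq> Field \<kappa>" if "\<alpha> \<in> Field ?K" for \<alpha>
  proof -
    have "|underS ?K \<alpha>| \<le>o \<kappa>"
      using card_of_underS[OF K(1) that] cardSuc_ordLeq_ordLess[OF Card card_of_Card_order] by blast
    then have "|underS ?K \<alpha>| \<le>o |Field \<kappa>|"
      using card_of_Field_ordIso[OF Card] ordIso_symmetric ordLeq_ordIso_trans by blast
    then show ?thesis unfolding card_of_ordLeq[symmetric] .
  qed
  then obtain e where e: "\<And>\<alpha>. \<alpha> \<in> Field ?K \<Longrightarrow> inj_on (e \<alpha>) (underS ?K \<alpha>)"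
    "\<And>\<alpha>. \<alpha> \<in> Field ?K \<Longrightarrow> e \<alpha> ` underS ?K \<alpha> \<subseteq> Field \<kappa>" by metis
  define u where "u \<alpha> i = {\<gamma> \<in> underS ?K \<alpha>. e \<alpha> \<gamma> \<in> underS \<kappa> i}" for \<alpha> i
  define lo where "lo \<alpha> i \<gamma> = (if \<gamma> \<in> u \<alpha> i then 1 else 0 :: nat)" for \<alpha> i \<gamma>
  define hi where "hi \<alpha> i \<gamma> = (if \<gamma> \<in> underS ?K \<alpha> then lo \<alpha> i \<gamma> else 2)" for \<alpha> i \<gamma>
  have u_small: "|u \<alpha> i| <o \<kappa>" if "\<alpha> \<in> Field ?K" "i \<in> Field \<kappa>" for \<alpha> i
  proof -
    have "inj_on (e \<alpha>) (u \<alpha> i)" using inj_on_subset[OF e(1)[OF that(1)]] by (auto simp: u_def)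
    then have "|u \<alpha> i| \<le>o |underS \<kappa> i|" by (intro card_of_ordLeqI) (auto simp: u_def)
    then show ?thesis using card_of_underS[OF Card that(2)] ordLeq_ordLess_trans by blast
  qed
  have coherent: "\<forall>\<^sub>F i in F. u \<alpha> i = u \<beta> i \<inter> underS ?K \<alpha> \<and> \<alpha> \<in> u \<beta> i" if ab: "\<alpha> \<in> underS ?K \<beta>" for \<alpha> \<beta>
  proof -
    note F = underS_in_Field[OF ab]
    have sub: "underS ?K \<alpha> \<subseteq> underS ?K \<beta>" using underS_trans[OF K(2) _ ab] by blast
    have "\<forall>\<^sub>F i in F. \<forall>\<gamma>\<in>underS ?K \<alpha>. e \<alpha> \<gamma> \<in> underS \<kappa> i \<longleftrightarrow> e \<beta> \<gamma> \<in> underS \<kappa> i"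
      using e(2)[OF F(2)] sub
      by (intro eventually_same_initial_part[OF e(1,2)[OF F(1)] inj_on_subset[OF e(1)[OF F(2)] sub]]) blast
    moreover have "e \<beta> \<alpha> \<in> Field \<kappa>" using e(2)[OF F(2)] ab by blast
    note eventually_above[OF this]
    ultimately show ?thesis by eventually_elim (use ab sub in \<open>auto simp: u_def\<close>)
  qed
  let ?P = "lex_less ?K"
  have lo_hi: "?P (lo \<alpha> i) (hi \<alpha> i)" if "\<alpha> \<in> Field ?K" for \<alpha> i
    using that by (intro lex_lessI[of \<alpha>]) (auto simp: lo_def hi_def u_def underS_irrefl)
  have lo_less: "?P (lo \<alpha> i) (lo \<beta> i)" and hi_less: "?P (hi \<beta> i) (hi \<alpha> i)"
    if ab: "\<alpha> \<in> underS ?K \<beta>" and eq: "u \<alpha> i = u \<beta> i \<inter> underS ?K \<alpha>" "\<alpha> \<in> u \<beta> i" for \<alpha> \<beta> i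
  proof -
    have sub: "underS ?K \<alpha> \<subseteq> underS ?K \<beta>" using underS_trans[OF K(2) _ ab] by blast
    have "\<alpha> \<in> Field ?K" using underS_in_Field[OF ab] by simp
    then show "?P (lo \<alpha> i) (lo \<beta> i)"
      by (rule lex_lessI) (use eq underS_irrefl[of \<alpha> ?K] in \<open>auto simp: lo_def\<close>)
    show "?P (hi \<beta> i) (hi \<alpha> i)"
      by (rule lex_lessI[OF \<open>\<alpha> \<in> Field ?K\<close>])
        (use eq ab sub underS_irrefl[of \<alpha> ?K] in \<open>auto simp: lo_def hi_def\<close>)
  qed
  have disjoint: "?P (hi \<alpha> i) (lo \<beta> i) \<or> ?P (hi \<beta> i) (lo \<alpha> i)"
    if ab: "\<alpha> \<in> underS ?K \<beta>" and neq: "u \<alpha> i \<noteq> u \<beta> i \<inter> underS ?K \<alpha>" for \<alpha> \<beta> i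
  proof -
    have sub: "underS ?K \<alpha> \<subseteq> underS ?K \<beta>" using underS_trans[OF K(2) _ ab] by blast
    let ?N = "{\<gamma> \<in> underS ?K \<alpha>. \<gamma> \<in> u \<alpha> i \<longleftrightarrow> \<gamma> \<notin> u \<beta> i}"
    obtain \<gamma> where \<gamma>: "\<gamma> \<in> ?N" using neq by (auto simp: u_def)
    have N: "?N \<subseteq> Field ?K" by (auto dest: underS_in_Field(1))
    obtain \<delta> where \<delta>: "\<delta> \<in> ?N" "\<And>\<gamma>. \<gamma> \<in> underS ?K \<delta> \<Longrightarrow> \<gamma> \<notin> ?N"
      by (rule Well_order_least[OF K(2) N \<gamma>]) blast
    have \<delta>F: "\<delta> \<in> Field ?K" using \<delta>(1) by (auto dest: underS_in_Field(1))
    have below: "\<gamma> \<in> underS ?K \<alpha>" "\<gamma> \<in> underS ?K \<beta>" "lo \<alpha> i \<gamma> = lo \<beta> i \<gamma>" if "\<gamma> \<in> underS ?K \<delta>" for \<gamma>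
    proof -
      show "\<gamma> \<in> underS ?K \<alpha>" using \<delta>(1) underS_trans[OF K(2) that] by blast
      then show "\<gamma> \<in> underS ?K \<beta>" "lo \<alpha> i \<gamma> = lo \<beta> i \<gamma>" using sub \<delta>(2)[OF that] by (auto simp: lo_def)
    qed
    show ?thesis
    proof (cases "\<delta> \<in> u \<beta> i")
      case True
      have "?P (hi \<alpha> i) (lo \<beta> i)"
        by (rule lex_lessI[OF \<delta>F]) (use True \<delta>(1) below in \<open>auto simp: hi_def lo_def\<close>)
      then show ?thesis ..
    next
      case False
      have "?P (hi \<beta> i) (lo \<alpha> i)"
        by (rule lex_lessI[OF \<delta>F]) (use False \<delta>(1) sub below in \<open>auto simp: hi_def lo_def\<close>)
      then show ?thesis ..
    qed
  qed
  define Q where "Q = (\<lambda>(\<alpha>, i). lo \<alpha> i) ` (Field ?K \<times> Field \<kappa>) \<union> (\<lambda>(\<alpha>, i). hi \<alpha> i) ` (Field ?K \<times> Field \<kappa>)"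
  have Q: "lo \<alpha> i \<in> Q" "hi \<alpha> i \<in> Q" if "\<alpha> \<in> Field ?K" "i \<in> Field \<kappa>" for \<alpha> i
    using that by (auto simp: Q_def)
  have "|Q| \<le>o ?K"
  proof -
    have "|Field \<kappa>| \<le>o ?K"
      using ordIso_ordLeq_trans[OF card_of_Field_ordIso[OF Card] cardSuc_ordLeq[OF Card]] .
    then have "|Field ?K \<times> Field \<kappa>| \<le>o ?K"
      using card_of_Times_ordLeq_infinite_Field[OF K(3) _ _ K(1)]
        ordIso_imp_ordLeq[OF card_of_Field_ordIso[OF K(1)]] by blast
    then have "|f ` (Field ?K \<times> Field \<kappa>)| \<le>o ?K" for f :: "_ \<Rightarrow> 'k set \<Rightarrow> nat"
      by (rule ordLeq_transitive[OF card_of_image])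
    then show ?thesis unfolding Q_def by (intro card_of_Un_ordLeq_infinite_Field[OF K(3)] K(1))
  qed
  then obtain g where g: "\<And>s. s \<in> Q \<Longrightarrow> g s \<in> Field R"
    "\<And>s t. s \<in> Q \<Longrightarrow> t \<in> Q \<Longrightarrow> ?P s t \<Longrightarrow> (g s, g t) \<in> R"
    by (rule embed_partial_order[OF dense fills Card inf, where lt = ?P and Q = Q])
      (use lex_less_trans[OF K(2)] lex_less_irrefl in blast)+
  have rep_lo: "\<exists>x. x \<in> Field S \<and> (\<forall>\<^sub>F i in F. rep x i = g (lo \<alpha> i))"
    and rep_hi: "\<exists>x. x \<in> Field S \<and> (\<forall>\<^sub>F i in F. rep x i = g (hi \<alpha> i))"
    if \<alpha>: "\<alpha> \<in> Field ?K" for \<alpha>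
  proof -
    have "\<forall>\<^sub>F i in F. g (lo \<alpha> i) \<in> Field R" "\<forall>\<^sub>F i in F. g (hi \<alpha> i) \<in> Field R"
      using F_in by (eventually_elim, use g(1) Q[OF \<alpha>] in simp)+
    from this[THEN represented]
    show "\<exists>x. x \<in> Field S \<and> (\<forall>\<^sub>F i in F. rep x i = g (lo \<alpha> i))"
      "\<exists>x. x \<in> Field S \<and> (\<forall>\<^sub>F i in F. rep x i = g (hi \<alpha> i))" by blast+
  qed
  have "\<forall>\<alpha>\<in>Field ?K. \<exists>x. x \<in> Field S \<and> (\<forall>\<^sub>F i in F. rep x i = g (lo \<alpha> i))"
    using rep_lo by (intro ballI)
  from bchoice[OF this]
  obtain a where a: "\<And>\<alpha>. \<alpha> \<in> Field ?K \<Longrightarrow> a \<alpha> \<in> Field S"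
    "\<And>\<alpha>. \<alpha> \<in> Field ?K \<Longrightarrow> \<forall>\<^sub>F i in F. rep (a \<alpha>) i = g (lo \<alpha> i)" by auto
  have "\<forall>\<alpha>\<in>Field ?K. \<exists>x. x \<in> Field S \<and> (\<forall>\<^sub>F i in F. rep x i = g (hi \<alpha> i))"
    using rep_hi by (intro ballI)
  from bchoice[OF this]
  obtain b where b: "\<And>\<alpha>. \<alpha> \<in> Field ?K \<Longrightarrow> b \<alpha> \<in> Field S"
    "\<And>\<alpha>. \<alpha> \<in> Field ?K \<Longrightarrow> \<forall>\<^sub>F i in F. rep (b \<alpha>) i = g (hi \<alpha> i)" by auto
  have ab_less: "(a \<alpha>, b \<alpha>) \<in> S" if \<alpha>: "\<alpha> \<in> Field ?K" for \<alpha>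
  proof -
    have "\<forall>\<^sub>F i in F. (rep (a \<alpha>) i, rep (b \<alpha>) i) \<in> R"
      using a(2)[OF \<alpha>] b(2)[OF \<alpha>] F_in by eventually_elim (use g(2) Q[OF \<alpha>] lo_hi[OF \<alpha>] in auto)
    then show ?thesis using rep_less a(1) b(1) \<alpha> by simp
  qed
  have mono: "(a \<alpha>, a \<beta>) \<in> S" "(b \<beta>, b \<alpha>) \<in> S" if \<alpha>\<beta>: "\<alpha> \<in> underS ?K \<beta>" for \<alpha> \<beta>
  proof -
    note F = underS_in_Field[OF \<alpha>\<beta>]
    have "\<forall>\<^sub>F i in F. (rep (a \<alpha>) i, rep (a \<beta>) i) \<in> R"
      using a(2)[OF F(1)] a(2)[OF F(2)] coherent[OF \<alpha>\<beta>] F_in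
      by eventually_elim (use g(2) Q[OF F(1)] Q[OF F(2)] lo_less[OF \<alpha>\<beta>] in auto)
    then show "(a \<alpha>, a \<beta>) \<in> S" using rep_less a(1) F by simp
    have "\<forall>\<^sub>F i in F. (rep (b \<beta>) i, rep (b \<alpha>) i) \<in> R"
      using b(2)[OF F(1)] b(2)[OF F(2)] coherent[OF \<alpha>\<beta>] F_in
      by eventually_elim (use g(2) Q[OF F(1)] Q[OF F(2)] hi_less[OF \<alpha>\<beta>] in auto)
    then show "(b \<beta>, b \<alpha>) \<in> S" using rep_less b(1) F by simp
  qed
  have "cut_sequences S ?K a b"
    unfolding cut_sequences_def
  proof (intro conjI allI impI ballI mono)
    show "a ` Field ?K \<subseteq> Field S" "b ` Field ?K \<subseteq> Field S" using a(1) b(1) by auto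
    show "(a \<alpha>, b \<beta>) \<in> S" if \<alpha>\<beta>: "\<alpha> \<in> Field ?K" "\<beta> \<in> Field ?K" for \<alpha> \<beta>
    proof -
      obtain \<gamma> where \<gamma>: "\<gamma> \<in> Field ?K" "\<alpha> \<in> underS ?K \<gamma>" "\<beta> \<in> underS ?K \<gamma>"
        by (rule Card_order_underS_upper[OF K(1,3) \<alpha>\<beta>])
      show ?thesis using mono(1)[OF \<gamma>(2)] ab_less[OF \<gamma>(1)] mono(2)[OF \<gamma>(3)] transD[OF S_trans] by blast
    qed
    show "\<not> (\<exists>x\<in>Field S. \<forall>\<alpha>\<in>Field ?K. \<forall>\<beta>\<in>Field ?K. (a \<alpha>, x) \<in> S \<and> (x, b \<beta>) \<in> S)"
    proof
      assume "\<exists>x\<in>Field S. \<forall>\<alpha>\<in>Field ?K. \<forall>\<beta>\<in>Field ?K. (a \<alpha>, x) \<in> S \<and> (x, b \<beta>) \<in> S"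
      then obtain x where x: "\<And>\<alpha>. \<alpha> \<in> Field ?K \<Longrightarrow> (a \<alpha>, x) \<in> S \<and> (x, b \<alpha>) \<in> S" by blast
      define N where "N i = {\<alpha> \<in> Field ?K. (g (lo \<alpha> i), rep x i) \<in> R \<and> (rep x i, g (hi \<alpha> i)) \<in> R}" for i
      have ev_N: "\<forall>\<^sub>F i in F. \<alpha> \<in> N i" if \<alpha>: "\<alpha> \<in> Field ?K" for \<alpha>
        using S_less[OF conjunct1[OF x[OF \<alpha>]]] S_less[OF conjunct2[OF x[OF \<alpha>]]] a(2)[OF \<alpha>] b(2)[OF \<alpha>]
        by eventually_elim (simp add: N_def \<alpha>)
      have chain: "u \<alpha> i = u \<beta> i \<inter> underS ?K \<alpha>"
        if \<alpha>\<beta>: "\<alpha> \<in> N i" "\<beta> \<in> N i" "\<alpha> \<in> underS ?K \<beta>" and i: "i \<in> Field \<kappa>" for \<alpha> \<beta> i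
      proof (rule ccontr)
        assume "u \<alpha> i \<noteq> u \<beta> i \<inter> underS ?K \<alpha>"
        from disjoint[OF \<alpha>\<beta>(3) this] have "(g (hi \<alpha> i), g (lo \<beta> i)) \<in> R \<or> (g (hi \<beta> i), g (lo \<alpha> i)) \<in> R"
          using g(2) Q i \<alpha>\<beta>(1,2) by (auto simp: N_def)
        then have "(rep x i, rep x i) \<in> R" using \<alpha>\<beta>(1,2) R_trans unfolding N_def by blast
        then show False using R_irrefl by blast
      qed
      define B where "B i = (\<Union>\<alpha>\<in>N i. u \<alpha> i)" for i
      have BF: "B i \<subseteq> Field ?K" for i
        by (auto simp: B_def u_def dest: underS_in_Field(1))
      have B_small: "|B i| \<le>o \<kappa>" if i: "i \<in> Field \<kappa>" for i
      proof (rule card_of_small_initial_segments[OF Card K(2) BF])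
        fix \<gamma> assume "\<gamma> \<in> B i"
        then obtain \<alpha> where \<alpha>: "\<alpha> \<in> N i" "\<gamma> \<in> u \<alpha> i" by (auto simp: B_def)
        have "\<delta> \<in> u \<alpha> i" if \<delta>: "\<delta> \<in> B i" "\<delta> \<in> underS ?K \<gamma>" for \<delta>
        proof -
          obtain \<beta> where \<beta>: "\<beta> \<in> N i" "\<delta> \<in> u \<beta> i" using \<delta>(1) by (auto simp: B_def)
          have "\<alpha> \<in> Field ?K" "\<beta> \<in> Field ?K" using \<alpha>(1) \<beta>(1) by (auto simp: N_def)
          from underS_total[OF K(2) this] show ?thesis
          proof (elim disjE)
            assume "\<alpha> \<in> underS ?K \<beta>"
            moreover have "\<delta> \<in> underS ?K \<alpha>" using \<delta>(2) \<alpha>(2) underS_trans[OF K(2)] by (auto simp: u_def)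
            ultimately show ?thesis using chain[OF \<alpha>(1) \<beta>(1) _ i] \<beta>(2) by blast
          next
            assume "\<beta> \<in> underS ?K \<alpha>"
            then show ?thesis using chain[OF \<beta>(1) \<alpha>(1) _ i] \<beta>(2) by blast
          qed (use \<beta>(2) in simp)
        qed
        then have "B i \<inter> underS ?K \<gamma> \<subseteq> u \<alpha> i" by blast
        moreover have "\<alpha> \<in> Field ?K" using \<alpha>(1) by (simp add: N_def)
        ultimately show "|B i \<inter> underS ?K \<gamma>| <o \<kappa>" using card_of_subset_ordLess u_small i by blast
      qed
      have "|\<Union>i\<in>Field \<kappa>. B i| \<le>o \<kappa>"
        using card_of_UNION_ordLeq_infinite_Field[OF inf Card] B_small
          ordIso_imp_ordLeq[OF card_of_Field_ordIso[OF Card]] by blast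
      then obtain \<beta> where \<beta>: "\<beta> \<in> Field ?K" "(\<Union>i\<in>Field \<kappa>. B i) \<subseteq> underS ?K \<beta>"
        using cardSuc_bounded[OF Card inf] BF by (metis UN_least)
      obtain \<alpha> where \<alpha>: "\<alpha> \<in> Field ?K" "\<beta> \<in> underS ?K \<alpha>"
        by (rule Card_order_underS_upper[OF K(1,3) \<beta>(1) \<beta>(1)])
      have "\<forall>\<^sub>F i in F. \<beta> \<in> underS ?K \<beta>"
        using ev_N[OF \<alpha>(1)] coherent[OF \<alpha>(2)] F_in
        by eventually_elim (use \<beta>(2) in \<open>auto simp: B_def\<close>)
      then show False using ultra_ex[OF ultra] underS_irrefl by metis
    qed
  qed
  then show ?thesis unfolding has_cut_iff by (intro exI)
qed

end

section \<open>Ultrapowers of models\<close>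

text \<open>As for orders, these conditions describe the ultrapower of \<open>M\<close> up to isomorphism.\<close>

locale model_ultrapower =
  fixes L :: "('f, 'r) language" and M :: "('f, 'r, 'm) struct" and N :: "('f, 'r, 'n) struct"
    and F :: "'i filter" and rep :: "'n \<Rightarrow> 'i \<Rightarrow> 'm"
  assumes ultra: "ultra F"
    and model: "is_model L M" "is_model L N"
    and rep_carrier: "x \<in> carrier N \<Longrightarrow> \<forall>\<^sub>F i in F. rep x i \<in> carrier M"
    and represented: "\<forall>\<^sub>F i in F. f i \<in> carrier M \<Longrightarrow> \<exists>x\<in>carrier N. \<forall>\<^sub>F i in F. rep x i = f i"
    and rep_eq: "x \<in> carrier N \<Longrightarrow> y \<in> carrier N \<Longrightarrow> x = y \<longleftrightarrow> (\<forall>\<^sub>F i in F. rep x i = rep y i)"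
    and rep_fint: "(g, length xs) \<in> funcs L \<Longrightarrow> set xs \<subseteq> carrier N \<Longrightarrow>
      \<forall>\<^sub>F i in F. rep (fint N g xs) i = fint M g (map (\<lambda>x. rep x i) xs)"
    and rep_rint: "(p, length xs) \<in> rels L \<Longrightarrow> set xs \<subseteq> carrier N \<Longrightarrow>
      rint N p xs \<longleftrightarrow> (\<forall>\<^sub>F i in F. rint M p (map (\<lambda>x. rep x i) xs))"
begin

lemma choose_element:
  assumes "\<forall>\<^sub>F i in F. \<exists>y\<in>carrier M. P i y"
  obtains x where "x \<in> carrier N" "\<forall>\<^sub>F i in F. P i (rep x i)"
proof -
  obtain f where f: "\<forall>\<^sub>F i in F. f i \<in> carrier M" "\<forall>\<^sub>F i in F. P i (f i)"
    by (rule eventually_choose[OF assms])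
  from represented[OF f(1)]
  obtain x where x: "x \<in> carrier N" "\<forall>\<^sub>F i in F. rep x i = f i" by (elim bexE)
  have "\<forall>\<^sub>F i in F. P i (rep x i)" using f(2) x(2) by eventually_elim simp
  then show thesis using that x(1) by blast
qed

lemma val_carrier:
  assumes "is_trm L t" "range e \<subseteq> carrier N"
  shows "val N e t \<in> carrier N"
  using assms(1)
proof (induction t)
  case (Fn g ts)
  have "set (map (val N e) ts) \<subseteq> carrier N" using Fn by auto
  then show ?case using Fn.prems model(2) unfolding is_model_def by fastforce
qed (use assms(2) in auto)

lemma rep_val:
  assumes "is_trm L t" "range e \<subseteq> carrier N"
  shows "\<forall>\<^sub>F i in F. rep (val N e t) i = val M (\<lambda>n. rep (e n) i) t"
  using assms(1)
proof (induction t)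
  case (Fn g ts)
  have "set (map (val N e) ts) \<subseteq> carrier N" using Fn.prems val_carrier[OF _ assms(2)] by auto
  moreover have "(g, length (map (val N e) ts)) \<in> funcs L" using Fn.prems by simp
  ultimately have "\<forall>\<^sub>F i in F. rep (val N e (Fn g ts)) i = fint M g (map (\<lambda>x. rep x i) (map (val N e) ts))"
    unfolding val.simps by (intro rep_fint)
  moreover have "\<forall>\<^sub>F i in F. \<forall>t\<in>set ts. rep (val N e t) i = val M (\<lambda>n. rep (e n) i) t"
    using Fn by (intro eventually_ball_finite) auto
  ultimately show ?case
  proof eventually_elim
    case (elim i)
    have "map (\<lambda>x. rep x i) (map (val N e) ts) = map (val M (\<lambda>n. rep (e n) i)) ts" using elim(2) by simp
    then show ?case using elim(1) by (simp only: val.simps)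
  qed
qed simp

text \<open>
  The theorem of Los.  In the universal case, a counterexample is chosen at each coordinate where
  there is one, and the chosen function represents a counterexample in \<open>N\<close>.
\<close>

lemma los:
  assumes "is_fm L \<phi>" "range e \<subseteq> carrier N"
  shows "sat N e \<phi> \<longleftrightarrow> (\<forall>\<^sub>F i in F. sat M (\<lambda>n. rep (e n) i) \<phi>)"
  using assms
proof (induction \<phi> arbitrary: e)
  case Falsum
  then show ?case using ultra_ex[OF ultra, of "\<lambda>_. False"] by auto
next
  case (Equal s t)
  have st: "is_trm L s" "is_trm L t" using Equal by auto
  have "\<forall>\<^sub>F i in F. (rep (val N e s) i = rep (val N e t) i) =
      (val M (\<lambda>n. rep (e n) i) s = val M (\<lambda>n. rep (e n) i) t)"
    using rep_val[OF st(1) Equal.prems(2)] rep_val[OF st(2) Equal.prems(2)] by eventually_elim simp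
  from eventually_subst[OF this] show ?case
    using rep_eq[OF val_carrier[OF st(1) Equal.prems(2)] val_carrier[OF st(2) Equal.prems(2)]] by simp
next
  case (Rel p ts)
  have ts: "(p, length (map (val N e) ts)) \<in> rels L" "set (map (val N e) ts) \<subseteq> carrier N"
    using Rel.prems val_carrier[OF _ Rel.prems(2)] by auto
  have "\<forall>\<^sub>F i in F. \<forall>t\<in>set ts. rep (val N e t) i = val M (\<lambda>n. rep (e n) i) t"
    using Rel.prems rep_val[OF _ Rel.prems(2)] by (intro eventually_ball_finite) auto
  then have "\<forall>\<^sub>F i in F. rint M p (map (\<lambda>x. rep x i) (map (val N e) ts)) =
      sat M (\<lambda>n. rep (e n) i) (Rel p ts)"
  proof eventually_elim
    case (elim i)
    have "map (\<lambda>x. rep x i) (map (val N e) ts) = map (val M (\<lambda>n. rep (e n) i)) ts" using elim by simp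
    then show ?case by (simp only: sat.simps)
  qed
  then have "(\<forall>\<^sub>F i in F. rint M p (map (\<lambda>x. rep x i) (map (val N e) ts))) =
      (\<forall>\<^sub>F i in F. sat M (\<lambda>n. rep (e n) i) (Rel p ts))" by (rule eventually_subst)
  then show ?case using rep_rint[OF ts] by (simp only: sat.simps)
next
  case (Imp \<phi> \<psi>)
  have IH: "sat N e \<phi> \<longleftrightarrow> (\<forall>\<^sub>F i in F. sat M (\<lambda>n. rep (e n) i) \<phi>)"
    "sat N e \<psi> \<longleftrightarrow> (\<forall>\<^sub>F i in F. sat M (\<lambda>n. rep (e n) i) \<psi>)" using Imp by auto
  show ?case
  proof
    assume imp: "sat N e (Imp \<phi> \<psi>)"
    show "\<forall>\<^sub>F i in F. sat M (\<lambda>n. rep (e n) i) (Imp \<phi> \<psi>)"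
    proof (cases "sat N e \<phi>")
      case True
      then have "\<forall>\<^sub>F i in F. sat M (\<lambda>n. rep (e n) i) \<psi>" using imp IH(2) by simp
      then show ?thesis by eventually_elim simp
    next
      case False
      then have "\<forall>\<^sub>F i in F. \<not> sat M (\<lambda>n. rep (e n) i) \<phi>" unfolding ultra_not[OF ultra] IH(1) .
      then show ?thesis by eventually_elim simp
    qed
  next
    assume imp: "\<forall>\<^sub>F i in F. sat M (\<lambda>n. rep (e n) i) (Imp \<phi> \<psi>)"
    have "sat N e \<psi>" if "sat N e \<phi>"
    proof -
      have "\<forall>\<^sub>F i in F. sat M (\<lambda>n. rep (e n) i) \<phi>" using that IH(1) by simp
      then have "\<forall>\<^sub>F i in F. sat M (\<lambda>n. rep (e n) i) \<psi>" using imp by eventually_elim simp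
      then show ?thesis using IH(2) by simp
    qed
    then show "sat N e (Imp \<phi> \<psi>)" by simp
  qed
next
  case (All v \<phi>)
  have shift: "(\<lambda>n. rep ((e(v := x)) n) i) = (\<lambda>n. rep (e n) i)(v := rep x i)" for x i by auto
  have IH: "sat N (e(v := x)) \<phi> \<longleftrightarrow> (\<forall>\<^sub>F i in F. sat M ((\<lambda>n. rep (e n) i)(v := rep x i)) \<phi>)"
    if x: "x \<in> carrier N" for x
  proof -
    have "is_fm L \<phi>" "range (e(v := x)) \<subseteq> carrier N" using All.prems x by auto
    from All.IH[OF this] show ?thesis unfolding shift .
  qed
  show ?case
  proof
    assume all: "sat N e (All v \<phi>)"
    show "\<forall>\<^sub>F i in F. sat M (\<lambda>n. rep (e n) i) (All v \<phi>)"
    proof (rule ccontr)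
      assume "\<not> (\<forall>\<^sub>F i in F. sat M (\<lambda>n. rep (e n) i) (All v \<phi>))"
      then have "\<forall>\<^sub>F i in F. \<not> sat M (\<lambda>n. rep (e n) i) (All v \<phi>)" unfolding ultra_not[OF ultra] .
      then have "\<forall>\<^sub>F i in F. \<exists>y\<in>carrier M. \<not> sat M ((\<lambda>n. rep (e n) i)(v := y)) \<phi>" by eventually_elim simp
      then obtain x where x: "x \<in> carrier N" "\<forall>\<^sub>F i in F. \<not> sat M ((\<lambda>n. rep (e n) i)(v := rep x i)) \<phi>"
        by (rule choose_element)
      then have "\<not> sat N (e(v := x)) \<phi>" unfolding IH[OF x(1)] ultra_not[OF ultra] by simp
      then show False using all x(1) by simp
    qed
  next
    assume all: "\<forall>\<^sub>F i in F. sat M (\<lambda>n. rep (e n) i) (All v \<phi>)"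
    have "sat N (e(v := x)) \<phi>" if x: "x \<in> carrier N" for x
      unfolding IH[OF x] using all rep_carrier[OF x] by eventually_elim simp
    then show "sat N e (All v \<phi>)" by simp
  qed
qed

lemma ord_of_rep:
  assumes "(lt, 2) \<in> rels L" "x \<in> carrier N" "y \<in> carrier N"
  shows "(x, y) \<in> ord_of N lt \<longleftrightarrow> (\<forall>\<^sub>F i in F. (rep x i, rep y i) \<in> ord_of M lt)"
proof -
  have "\<forall>\<^sub>F i in F. rint M lt [rep x i, rep y i] = ((rep x i, rep y i) \<in> ord_of M lt)"
    using rep_carrier[OF assms(2)] rep_carrier[OF assms(3)] by eventually_elim (simp add: ord_of_def)
  then have "(\<forall>\<^sub>F i in F. rint M lt [rep x i, rep y i]) = (\<forall>\<^sub>F i in F. (rep x i, rep y i) \<in> ord_of M lt)"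
    by (rule eventually_subst)
  moreover have "rint N lt [x, y] = (\<forall>\<^sub>F i in F. rint M lt [rep x i, rep y i])"
    using rep_rint[of lt "[x, y]"] assms by (simp add: numeral_2_eq_2)
  ultimately show ?thesis using assms(2,3) by (simp add: ord_of_def)
qed

text \<open>
  A function into the field of the order represents a point of the field, and not just of the
  carrier, because each of its values has a comparable element, and choosing one at every
  coordinate gives a point comparable to it.
\<close>

lemma ord_of_ultrapower:
  assumes lt: "(lt, 2) \<in> rels L" and dense: "dense_linear_order (ord_of M lt)"
  shows "order_ultrapower (ord_of M lt) (ord_of N lt) F rep"
proof
  let ?R = "ord_of M lt" and ?S = "ord_of N lt"
  have R: "Field ?R \<subseteq> carrier M" and S: "Field ?S \<subseteq> carrier N" by (auto simp: ord_of_def Field_def)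
  show "ultra F" by (rule ultra)
  show "dense_linear_order ?R" by (rule dense)
  show "(x, y) \<in> ?S \<longleftrightarrow> (\<forall>\<^sub>F i in F. (rep x i, rep y i) \<in> ?R)" if "x \<in> Field ?S" "y \<in> Field ?S" for x y
    using ord_of_rep[OF lt] that S by blast
  show "x = y" if "x \<in> Field ?S" "y \<in> Field ?S" "\<forall>\<^sub>F i in F. rep x i = rep y i" for x y
    using rep_eq that S by blast
  show "\<forall>\<^sub>F i in F. rep x i \<in> Field ?R" if x: "x \<in> Field ?S" for x
  proof -
    obtain y where y: "(x, y) \<in> ?S \<or> (y, x) \<in> ?S" using x by (auto simp: Field_def)
    then have c: "x \<in> carrier N" "y \<in> carrier N" by (auto simp: ord_of_def)
    from y have "(\<forall>\<^sub>F i in F. (rep x i, rep y i) \<in> ?R) \<or> (\<forall>\<^sub>F i in F. (rep y i, rep x i) \<in> ?R)"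
      using ord_of_rep[OF lt] c by blast
    then show ?thesis
    proof
      assume "\<forall>\<^sub>F i in F. (rep x i, rep y i) \<in> ?R"
      then show ?thesis by (rule eventually_mono) (rule FieldI1)
    next
      assume "\<forall>\<^sub>F i in F. (rep y i, rep x i) \<in> ?R"
      then show ?thesis by (rule eventually_mono) (rule FieldI2)
    qed
  qed
  show "\<exists>x\<in>Field ?S. \<forall>\<^sub>F i in F. rep x i = f i" if f: "\<forall>\<^sub>F i in F. f i \<in> Field ?R" for f
  proof -
    have "\<forall>\<^sub>F i in F. f i \<in> carrier M" using f by (rule eventually_mono) (use R in blast)
    from represented[OF this] obtain x where x: "x \<in> carrier N" "\<forall>\<^sub>F i in F. rep x i = f i" by (elim bexE)
    have "\<forall>\<^sub>F i in F. rep x i \<in> Field ?R" using f x(2) by eventually_elim simp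
    then have "\<forall>\<^sub>F i in F. \<exists>y\<in>carrier M. (rep x i, y) \<in> ?R \<or> (y, rep x i) \<in> ?R"
      by (rule eventually_mono) (auto simp: Field_def ord_of_def)
    then obtain y where y: "y \<in> carrier N" "\<forall>\<^sub>F i in F. (rep x i, rep y i) \<in> ?R \<or> (rep y i, rep x i) \<in> ?R"
      by (rule choose_element)
    have "(x, y) \<in> ?S \<or> (y, x) \<in> ?S"
    proof (rule ccontr)
      assume "\<not> ?thesis"
      then have "\<forall>\<^sub>F i in F. (rep x i, rep y i) \<notin> ?R" "\<forall>\<^sub>F i in F. (rep y i, rep x i) \<notin> ?R"
        unfolding ultra_not[OF ultra] using ord_of_rep[OF lt] x(1) y(1) by blast+
      then have "\<forall>\<^sub>F i in F. False" using y(2) by eventually_elim blast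
      then show False using ultra_ex[OF ultra] by blast
    qed
    then have "x \<in> Field ?S" by (auto simp: Field_def)
    then show ?thesis using x(2) by blast
  qed
qed

end

text \<open>
  The quotient interprets symbols through a choice of representatives.  The same choice, composed
  with the isomorphism, serves as \<open>rep\<close>.
\<close>

lemma ultrapower_representation:
  fixes M :: "('f, 'r, 'm) struct" and N :: "('f, 'r, 'n) struct"
  assumes D: "ultrafilter_on I D" and M: "is_model L M" and N: "is_model L N"
    and iso: "isomorphic L N (ultrapower I D M)"
  shows "\<exists>rep. model_ultrapower L M N (ufilter I D) rep"
proof -
  let ?U = "ultrapower I D M" and ?q = "ueq I D M" and ?fn = "I \<rightarrow>\<^sub>E carrier M"
  obtain h where bij: "bij_betw h (carrier N) (carrier ?U)"
    and hf: "\<forall>(f, n)\<in>funcs L. \<forall>as. length as = n \<longrightarrow> set as \<subseteq> carrier N \<longrightarrow> h (fint N f as) = fint ?U f (map h as)"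
    and hr: "\<forall>(p, n)\<in>rels L. \<forall>as. length as = n \<longrightarrow> set as \<subseteq> carrier N \<longrightarrow> (rint N p as \<longleftrightarrow> rint ?U p (map h as))"
    using iso unfolding isomorphic_def by (elim exE conjE)
  note ev = eventually_ufilter[OF D] and ev_in = eventually_ufilter_in[OF D]
  have q: "(f, g) \<in> ?q \<longleftrightarrow> f \<in> ?fn \<and> g \<in> ?fn \<and> (\<forall>\<^sub>F i in ufilter I D. f i = g i)" for f g
    by (simp add: ueq_def ev)
  have equiv: "equiv ?fn ?q"
  proof (rule equivI)
    show "?q \<subseteq> ?fn \<times> ?fn" by (auto simp: ueq_def)
    show "refl_on ?fn ?q" by (auto simp: refl_on_def q)
    show "sym ?q" by (auto simp: sym_def q elim: eventually_mono)
    show "trans ?q"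
    proof (rule transI)
      fix f g k assume "(f, g) \<in> ?q" "(g, k) \<in> ?q"
      then show "(f, k) \<in> ?q" unfolding q by (auto elim: eventually_elim2)
    qed
  qed
  have carrier_U: "carrier ?U = ?fn // ?q" by (simp add: ultrapower_def)
  define rep where "rep x = (SOME g. g \<in> h x)" for x
  have rep_in: "rep x \<in> h x" if "x \<in> carrier N" for x
  proof -
    have "h x \<in> ?fn // ?q" using bij that carrier_U by (auto simp: bij_betw_def)
    then have "h x \<noteq> {}" using in_quotient_imp_non_empty[OF equiv] by blast
    then show ?thesis unfolding rep_def by (simp add: some_in_eq)
  qed
  have hx: "h x = ?q `` {rep x}" "rep x \<in> ?fn" if "x \<in> carrier N" for x
  proof -
    have "h x \<in> ?fn // ?q" using bij that carrier_U by (auto simp: bij_betw_def)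
    then obtain g where g: "h x = ?q `` {g}" by (rule quotientE)
    have gr: "(g, rep x) \<in> ?q" using rep_in[OF that] g by simp
    then show "rep x \<in> ?fn" by (simp add: q)
    show "h x = ?q `` {rep x}" using equiv_class_eq[OF equiv gr] g by simp
  qed
  have rep_cong: "\<forall>\<^sub>F i in ufilter I D. rep x i = g i" if "x \<in> carrier N" "h x = ?q `` {g}" "g \<in> ?fn" for x g
  proof -
    have "rep x \<in> ?q `` {g}" using rep_in[OF that(1)] that(2) by simp
    then have "\<forall>\<^sub>F i in ufilter I D. g i = rep x i" by (simp add: q)
    then show ?thesis by (rule eventually_mono) simp
  qed
  have "model_ultrapower L M N (ufilter I D) rep"
  proof
    show "ultra (ufilter I D)" by (rule ultra_ufilter[OF D])
    show "is_model L M" by (rule M)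
    show "is_model L N" by (rule N)
    show "\<forall>\<^sub>F i in ufilter I D. rep x i \<in> carrier M" if "x \<in> carrier N" for x
      using ev_in by (rule eventually_mono) (use hx(2)[OF that] in auto)
    show "\<exists>x\<in>carrier N. \<forall>\<^sub>F i in ufilter I D. rep x i = f i" if f: "\<forall>\<^sub>F i in ufilter I D. f i \<in> carrier M" for f
    proof -
      obtain c where c: "c \<in> carrier M" using M by (auto simp: is_model_def)
      define g where "g = (\<lambda>i\<in>I. if f i \<in> carrier M then f i else c)"
      have g: "g \<in> ?fn" using c by (auto simp: g_def)
      then have "?q `` {g} \<in> h ` carrier N" using bij carrier_U quotientI[of g ?fn ?q] by (auto simp: bij_betw_def)
      then obtain x where x: "x \<in> carrier N" "h x = ?q `` {g}" by auto
      have "\<forall>\<^sub>F i in ufilter I D. rep x i = f i"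
        using rep_cong[OF x g] f ev_in by eventually_elim (simp add: g_def)
      then show ?thesis using x(1) by blast
    qed
    show "x = y \<longleftrightarrow> (\<forall>\<^sub>F i in ufilter I D. rep x i = rep y i)" if xy: "x \<in> carrier N" "y \<in> carrier N" for x y
    proof
      assume "\<forall>\<^sub>F i in ufilter I D. rep x i = rep y i"
      then have "(rep x, rep y) \<in> ?q" using hx(2) xy by (simp add: q)
      then have "h x = h y" using hx(1) xy equiv_class_eq[OF equiv] by metis
      then show "x = y" using bij xy by (auto simp: bij_betw_def inj_on_def)
    qed simp
    have choice: "map (\<lambda>c. (SOME g. g \<in> c) i) (map h xs) = map (\<lambda>x. rep x i) xs" for xs i
      by (simp add: rep_def)
    show "\<forall>\<^sub>F i in ufilter I D. rep (fint N f xs) i = fint M f (map (\<lambda>x. rep x i) xs)"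
      if f: "(f, length xs) \<in> funcs L" "set xs \<subseteq> carrier N" for f xs
    proof -
      have x: "fint N f xs \<in> carrier N" using N f unfolding is_model_def by blast
      let ?g = "\<lambda>i\<in>I. fint M f (map (\<lambda>x. rep x i) xs)"
      have "fint M f (map (\<lambda>x. rep x i) xs) \<in> carrier M" if i: "i \<in> I" for i
      proof -
        have "set (map (\<lambda>x. rep x i) xs) \<subseteq> carrier M" using hx(2) f(2) i by fastforce
        moreover have "(f, length (map (\<lambda>x. rep x i) xs)) \<in> funcs L" using f(1) by simp
        ultimately show ?thesis using M unfolding is_model_def by blast
      qed
      then have g: "?g \<in> ?fn" by auto
      have "h (fint N f xs) = fint ?U f (map h xs)" using hf f by blast
      also have "\<dots> = ?q `` {?g}" by (simp only: ultrapower_def struct.simps choice)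
      finally show ?thesis
        using rep_cong[OF x _ g] ev_in by (auto elim: eventually_elim2)
    qed
    show "rint N p xs \<longleftrightarrow> (\<forall>\<^sub>F i in ufilter I D. rint M p (map (\<lambda>x. rep x i) xs))"
      if p: "(p, length xs) \<in> rels L" "set xs \<subseteq> carrier N" for p xs
    proof -
      have "rint N p xs \<longleftrightarrow> rint ?U p (map h xs)" using hr p by blast
      also have "\<dots> \<longleftrightarrow> (\<forall>\<^sub>F i in ufilter I D. rint M p (map (\<lambda>x. rep x i) xs))"
        unfolding ev by (simp only: ultrapower_def struct.simps choice)
      finally show ?thesis .
    qed
  qed
  then show ?thesis by blast
qed

section \<open>Saturation\<close>

instance trm :: (countable) countable by countable_datatype
instance fm :: (countable, countable) countable by countable_datatype

lemma set_trm_subset: "is_trm L t \<Longrightarrow> set_trm t \<subseteq> fst ` funcs L"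
proof (induction t)
  case (Fn g ts)
  have "g \<in> fst ` funcs L" using Fn.prems by (auto intro: rev_image_eqI)
  moreover have "set_trm t \<subseteq> fst ` funcs L" if "t \<in> set ts" for t using Fn that by simp
  ultimately show ?case by auto
qed simp

lemma set1_fm_subset: "is_fm L \<phi> \<Longrightarrow> set1_fm \<phi> \<subseteq> fst ` funcs L"
proof (induction \<phi>)
  case (Equal s t)
  then show ?case using set_trm_subset[of L s] set_trm_subset[of L t] by simp
next
  case (Rel p ts)
  have "set_trm t \<subseteq> fst ` funcs L" if "t \<in> set ts" for t using Rel that set_trm_subset[of L t] by simp
  then show ?case by auto
qed simp_all

lemma set2_fm_subset: "is_fm L \<phi> \<Longrightarrow> set2_fm \<phi> \<subseteq> fst ` rels L"
proof (induction \<phi>)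
  case (Rel p ts)
  then show ?case by (auto intro: rev_image_eqI)
qed simp_all

lemma countable_formulas:
  assumes "countable_language L"
  shows "countable {\<phi>. is_fm L \<phi>}"
proof -
  let ?A = "fst ` funcs L" and ?B = "fst ` rels L"
  have c: "countable ?A" "countable ?B" using assms by (auto simp: countable_language_def)
  have "inj_on (map_fm (to_nat_on ?A) (to_nat_on ?B)) {\<phi>. is_fm L \<phi>}"
  proof (rule inj_onI)
    fix \<phi> \<psi> assume *: "\<phi> \<in> {\<phi>. is_fm L \<phi>}" "\<psi> \<in> {\<phi>. is_fm L \<phi>}"
      "map_fm (to_nat_on ?A) (to_nat_on ?B) \<phi> = map_fm (to_nat_on ?A) (to_nat_on ?B) \<psi>"
    show "\<phi> = \<psi>"
    proof (rule fm.inj_map_strong[OF _ _ *(3)])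
      show "x = y" if "x \<in> set1_fm \<phi>" "y \<in> set1_fm \<psi>" "to_nat_on ?A x = to_nat_on ?A y" for x y
        using that *(1,2) set1_fm_subset inj_on_to_nat_on[OF c(1)] by (blast dest: inj_onD)
      show "x = y" if "x \<in> set2_fm \<phi>" "y \<in> set2_fm \<psi>" "to_nat_on ?B x = to_nat_on ?B y" for x y
        using that *(1,2) set2_fm_subset inj_on_to_nat_on[OF c(2)] by (blast dest: inj_onD)
    qed
  qed
  then show ?thesis by (rule countableI')
qed

lemma card_of_lists_ordLeq:
  assumes B: "infinite B" and X: "|X| \<le>o |B|"
  shows "|lists X| \<le>o |B|"
proof -
  have len: "|{xs \<in> lists X. length xs = n}| \<le>o |B|" for n
  proof (induction n)
    case 0
    have "{xs \<in> lists X. length xs = 0} = {[]}" by auto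
    moreover have "B \<noteq> {}" using B by auto
    ultimately show ?case using card_of_singl_ordLeq by metis
  next
    case (Suc n)
    have eq: "{xs \<in> lists X. length xs = Suc n} = (\<lambda>(x, xs). x # xs) ` (X \<times> {xs \<in> lists X. length xs = n})"
      by (auto simp: length_Suc_conv image_iff)
    have "|X \<times> {xs \<in> lists X. length xs = n}| \<le>o |B|"
      by (rule card_of_Times_ordLeq_infinite_Field[OF _ X Suc card_of_Card_order]) (simp add: Field_card_of B)
    then show ?case unfolding eq by (rule ordLeq_transitive[OF card_of_image])
  qed
  have "|UNIV :: nat set| \<le>o |B|" using B infinite_iff_card_of_nat by blast
  then have "|\<Union>n. {xs \<in> lists X. length xs = n}| \<le>o |B|"
    using len by (intro card_of_UNION_ordLeq_infinite[OF B]) auto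
  moreover have "(\<Union>n. {xs \<in> lists X. length xs = n}) = lists X" by auto
  ultimately show ?thesis by simp
qed

lemma finite_fv_trm: "finite (fv_trm t)"
  by (induction t) auto

lemma finite_fv: "finite (fv \<phi>)"
  by (induction \<phi>) (auto simp: finite_fv_trm)

lemma val_cong: "(\<And>x. x \<in> fv_trm t \<Longrightarrow> e x = e' x) \<Longrightarrow> val M e t = val M e' t"
proof (induction t)
  case (Fn f ts)
  then have "map (val M e) ts = map (val M e') ts" by auto
  then show ?case by (simp only: val.simps)
qed simp

lemma sat_cong: "(\<And>x. x \<in> fv \<phi> \<Longrightarrow> e x = e' x) \<Longrightarrow> sat M e \<phi> = sat M e' \<phi>"
proof (induction \<phi> arbitrary: e e')
  case (Equal s t)
  have "val M e s = val M e' s" "val M e t = val M e' t" using Equal by (auto intro!: val_cong)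
  then show ?case by simp
next
  case (Rel p ts)
  have "val M e t = val M e' t" if "t \<in> set ts" for t using Rel that by (intro val_cong) auto
  then have "map (val M e) ts = map (val M e') ts" by simp
  then show ?case by (simp only: sat.simps)
next
  case (Imp \<phi> \<psi>)
  have "sat M e \<phi> = sat M e' \<phi>" using Imp.prems by (intro Imp.IH) auto
  moreover have "sat M e \<psi> = sat M e' \<psi>" using Imp.prems by (intro Imp.IH) auto
  ultimately show ?case by simp
next
  case (All x \<phi>)
  have "sat M (e(x := a)) \<phi> = sat M (e'(x := a)) \<phi>" for a using All by (intro All.IH) auto
  then show ?case by simp
qed simp

text \<open>
  A formula whose assignment is constant outside its parameters is determined by itself and the
  finite list of its parameters, so these formulas are no more than \<open>A\<close> together with the countably
  many formulas of the language.  Lists of them enumerate the finite subsets of \<open>P\<close>.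
\<close>

lemma card_of_param_fms:
  assumes "countable_language L" "|A| <o \<kappa>" "Card_order \<kappa>" "natLeq <o \<kappa>"
    and P: "P \<subseteq> param_fms L A" "\<And>\<phi> e n. (\<phi>, e) \<in> P \<Longrightarrow> n \<notin> fv \<phi> - {0} \<Longrightarrow> e n = c"
  shows "|lists P| <o \<kappa>"
proof -
  \<comment> \<open>an infinite set below \<open>\<kappa>\<close> that bounds both the parameters and the language\<close>
  let ?B = "A <+> (UNIV :: nat set)"
  have inf: "infinite (Field \<kappa>)" using assms(4) by (rule infinite_Field_natLeq)
  have "|UNIV :: nat set| <o \<kappa>" using assms(4) card_of_nat ordIso_ordLess_trans by blast
  then have B: "|?B| <o \<kappa>" using card_of_Plus_ordLess_infinite_Field[OF inf assms(3,2)] by blast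
  have infB: "infinite ?B" by simp
  define code where "code = (\<lambda>(\<phi> :: ('a, 'b) fm, e :: nat \<Rightarrow> 'c). (\<phi>, map e (sorted_list_of_set (fv \<phi> - {0}))))"
  have "inj_on code P"
  proof (rule inj_onI, clarify)
    fix \<phi> \<psi> e e' assume *: "(\<phi>, e) \<in> P" "(\<psi>, e') \<in> P" "code (\<phi>, e) = code (\<psi>, e')"
    then have eq: "\<phi> = \<psi>" by (simp add: code_def)
    have "map e (sorted_list_of_set (fv \<phi> - {0})) = map e' (sorted_list_of_set (fv \<phi> - {0}))"
      using *(3) eq by (simp only: code_def prod.case prod.inject)
    then have on: "e n = e' n" if "n \<in> fv \<phi> - {0}" for n
      using that finite_fv[of \<phi>] by (simp add: map_eq_conv)
    have "e n = e' n" for n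
    proof (cases "n \<in> fv \<phi> - {0}")
      case False
      then show ?thesis using P(2)[OF *(1) False] P(2)[OF *(2)] eq by simp
    qed (rule on)
    then have "e = e'" by (rule ext)
    then show "\<phi> = \<psi> \<and> e = e'" using eq by simp
  qed
  moreover have "code x \<in> {\<phi>. is_fm L \<phi>} \<times> lists A" if "x \<in> P" for x
  proof -
    obtain \<phi> e where x: "x = (\<phi>, e)" by (cases x)
    have "is_fm L \<phi>" "e ` (fv \<phi> - {0}) \<subseteq> A" using subsetD[OF P(1) that] x by (auto simp: param_fms_def)
    then show ?thesis using finite_fv[of \<phi>] by (auto simp: x code_def lists_eq_set)
  qed
  ultimately have "|P| \<le>o |{\<phi>. is_fm L \<phi>} \<times> lists A|" by (rule card_of_ordLeqI)
  also have "|{\<phi>. is_fm L \<phi>} \<times> lists A| \<le>o |?B|"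
  proof -
    have "|{\<phi>. is_fm L \<phi>}| \<le>o |UNIV :: nat set|"
      using inj_on_to_nat_on[OF countable_formulas[OF assms(1)]] by (rule card_of_ordLeqI) simp
    then have "|{\<phi>. is_fm L \<phi>}| \<le>o |?B|" using card_of_Plus2 ordLeq_transitive by blast
    moreover have "|lists A| \<le>o |?B|" using card_of_lists_ordLeq[OF infB card_of_Plus1] .
    ultimately show ?thesis
      by (rule card_of_Times_ordLeq_infinite_Field[OF _ _ _ card_of_Card_order, rotated]) (simp add: Field_card_of)
  qed
  finally have "|lists P| \<le>o |?B|" by (rule card_of_lists_ordLeq[OF infB])
  then show ?thesis using B ordLeq_ordLess_trans by blast
qed

locale normal_model_ultrapower =
  normal_measure \<kappa> E + model_ultrapower L M N "ufilter (Field \<kappa>) E" rep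
  for \<kappa> :: "'k rel" and E and L :: "('f, 'r) language" and M :: "('f, 'r, 'm) struct"
    and N :: "('f, 'r, 'n) struct" and rep
begin

text \<open>
  After parameters that do not occur are normalized, a type over a small set has fewer than \<open>\<kappa>\<close>
  finite subsets.  So by completeness almost all coordinates of the type are finitely satisfiable,
  and they are realized by saturation of \<open>M\<close>.
\<close>

lemma saturated_ultrapower:
  assumes L: "countable_language L" and M: "saturated L \<kappa> M"
  shows "saturated L \<kappa> N"
  unfolding saturated_def
proof (intro allI impI)
  fix A and p :: "(('f, 'r) fm \<times> (nat \<Rightarrow> 'n)) set"
  assume A: "A \<subseteq> carrier N" "|A| <o \<kappa>" and p: "p \<subseteq> param_fms L A"
    and fin: "\<forall>q. finite q \<longrightarrow> q \<subseteq> p \<longrightarrow> (\<exists>b\<in>carrier N. realizes N b q)"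
  obtain c where c: "c \<in> carrier N" using model(2) by (auto simp: is_model_def)
  define norm where "norm = (\<lambda>(\<phi> :: ('f, 'r) fm, e). (\<phi>, \<lambda>n. if n \<in> fv \<phi> - {0} then e n else c))"
  have realizes_norm: "realizes N b (norm ` q) \<longleftrightarrow> realizes N b q" for b q
  proof -
    have "sat N ((\<lambda>n. if n \<in> fv \<phi> - {0} then e n else c)(0 := b)) \<phi> = sat N (e(0 := b)) \<phi>" for \<phi> e
      by (rule sat_cong) auto
    then show ?thesis by (auto simp: realizes_def norm_def split: prod.splits)
  qed
  define P where "P = norm ` p"
  have P: "is_fm L \<phi>" "e ` (fv \<phi> - {0}) \<subseteq> A" "range e \<subseteq> carrier N" if e: "(\<phi>, e) \<in> P" for \<phi> e
  proof -
    obtain x where x: "x \<in> p" "(\<phi>, e) = norm x" using e by (auto simp only: P_def image_iff)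
    obtain \<phi>' e' where x': "x = (\<phi>', e')" by (cases x)
    have e': "(\<phi>, e') \<in> p" "e = (\<lambda>n. if n \<in> fv \<phi> - {0} then e' n else c)"
      using x unfolding x' norm_def by simp_all
    show "is_fm L \<phi>" using subsetD[OF p e'(1)] by (simp add: param_fms_def)
    have sub: "e' ` (fv \<phi> - {0}) \<subseteq> A" using subsetD[OF p e'(1)] by (simp add: param_fms_def)
    have e_n: "e n = (if n \<in> fv \<phi> - {0} then e' n else c)" for n by (simp only: e'(2))
    have in_A: "e n \<in> A" if "n \<in> fv \<phi> - {0}" for n
      unfolding e_n using that subsetD[OF sub imageI[OF that]] by simp
    then show "e ` (fv \<phi> - {0}) \<subseteq> A" by (rule image_subsetI)
    show "range e \<subseteq> carrier N"
    proof (rule image_subsetI)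
      fix n
      show "e n \<in> carrier N"
      proof (cases "n \<in> fv \<phi> - {0}")
        case True
        then show ?thesis using in_A A(1) by blast
      next
        case False
        then have "e n = c" unfolding e_n by (rule if_not_P)
        then show ?thesis using c by simp
      qed
    qed
  qed
  have "P \<subseteq> param_fms L A"
    by (rule subrelI) (simp only: param_fms_def mem_Collect_eq prod.case P(1,2) simp_thms)
  moreover have "e n = c" if "(\<phi>, e) \<in> P" "n \<notin> fv \<phi> - {0}" for \<phi> e n
    using that by (auto simp: P_def norm_def)
  ultimately have small: "|lists P| <o \<kappa>" by (rule card_of_param_fms[OF L A(2) Card natLeq_less])
  define coord where "coord i = (\<lambda>(\<phi> :: ('f, 'r) fm, e :: nat \<Rightarrow> 'n). (\<phi>, \<lambda>n. rep (e n) i))" for i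
  have los_b: "sat N (e(0 := b)) \<phi> \<longleftrightarrow> (\<forall>\<^sub>F i in F. sat M ((\<lambda>n. rep (e n) i)(0 := rep b i)) \<phi>)"
    if "(\<phi>, e) \<in> P" "b \<in> carrier N" for \<phi> e b
  proof -
    have "range (e(0 := b)) \<subseteq> carrier N" using P(3)[OF that(1)] that(2) by auto
    from los[OF P(1)[OF that(1)] this]
    have "sat N (e(0 := b)) \<phi> \<longleftrightarrow> (\<forall>\<^sub>F i in F. sat M (\<lambda>n. rep ((e(0 := b)) n) i) \<phi>)" .
    moreover have "(\<lambda>n. rep ((e(0 := b)) n) i) = (\<lambda>n. rep (e n) i)(0 := rep b i)" for i by auto
    ultimately show ?thesis by (simp only:)
  qed
  have "\<forall>\<^sub>F i in F. \<exists>y\<in>carrier M. realizes M y (coord i ` set xs)" if xs: "xs \<in> lists P" for xs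
  proof -
    have "set xs \<subseteq> norm ` p" using xs by (auto simp: P_def)
    from finite_subset_image[OF finite_set this]
    obtain q where q: "q \<subseteq> p" "finite q" "set xs = norm ` q" by blast
    obtain b where b: "b \<in> carrier N" "realizes N b q" using fin q(1,2) by blast
    then have real: "realizes N b (set xs)" unfolding q(3) realizes_norm by simp
    have "\<forall>\<^sub>F i in F. \<forall>(\<phi>, e)\<in>set xs. sat M ((\<lambda>n. rep (e n) i)(0 := rep b i)) \<phi>"
    proof (rule eventually_ball_finite[OF finite_set], rule ballI)
      fix x assume x: "x \<in> set xs"
      obtain \<phi> e where [simp]: "x = (\<phi>, e)" by (cases x)
      have "(\<phi>, e) \<in> P" using x xs by auto
      moreover have "sat N (e(0 := b)) \<phi>" using real x by (auto simp: realizes_def)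
      ultimately have "\<forall>\<^sub>F i in F. sat M ((\<lambda>n. rep (e n) i)(0 := rep b i)) \<phi>" using los_b b(1) by blast
      then show "\<forall>\<^sub>F i in F. case x of (\<phi>, e) \<Rightarrow> sat M ((\<lambda>n. rep (e n) i)(0 := rep b i)) \<phi>" by simp
    qed
    then show ?thesis using rep_carrier[OF b(1)]
    proof eventually_elim
      case (elim i)
      then show ?case by (intro bexI[of _ "rep b i"]) (auto simp: realizes_def coord_def)
    qed
  qed
  then have "\<forall>\<^sub>F i in F. \<forall>xs\<in>lists P. \<exists>y\<in>carrier M. realizes M y (coord i ` set xs)"
    by (rule eventually_small_ball[OF small])
  moreover have "\<forall>\<^sub>F i in F. \<forall>a\<in>A. rep a i \<in> carrier M"
    by (rule eventually_small_ball[OF A(2)], rule rep_carrier) (use A(1) in blast)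
  ultimately have "\<forall>\<^sub>F i in F. \<exists>y\<in>carrier M. realizes M y (coord i ` P)"
  proof eventually_elim
    case (elim i)
    let ?A = "(\<lambda>a. rep a i) ` A"
    have "\<exists>y\<in>carrier M. realizes M y q" if q: "finite q" "q \<subseteq> coord i ` P" for q
    proof -
      obtain q' where q': "q' \<subseteq> P" "finite q'" "q = coord i ` q'" using finite_subset_image[OF q] by blast
      obtain xs where "set xs = q'" using finite_list[OF q'(2)] by blast
      then show ?thesis using elim(1) q'(1,3) by (auto simp: lists_eq_set)
    qed
    moreover have "?A \<subseteq> carrier M" using elim(2) by blast
    moreover have "|?A| <o \<kappa>" using card_of_image_ordLess[OF A(2)] .
    moreover have "coord i ` P \<subseteq> param_fms L ?A"
    proof (rule image_subsetI)
      fix x assume x: "x \<in> P"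
      obtain \<phi> e where eq: "x = (\<phi>, e)" by (cases x)
      have "(\<lambda>n. rep (e n) i) ` (fv \<phi> - {0}) \<subseteq> ?A" using P(2)[of \<phi> e] x eq by blast
      then show "coord i x \<in> param_fms L ?A"
        using P(1) x by (simp add: eq coord_def param_fms_def)
    qed
    ultimately show ?case using M[unfolded saturated_def, rule_format, of ?A "coord i ` P"] by metis
  qed
  then obtain b where b: "b \<in> carrier N" "\<forall>\<^sub>F i in F. realizes M (rep b i) (coord i ` P)"
    by (rule choose_element)
  have "sat N (e(0 := b)) \<phi>" if x: "(\<phi>, e) \<in> P" for \<phi> e
    unfolding los_b[OF x b(1)] using b(2)
    by (rule eventually_mono) (use x in \<open>force simp: realizes_def coord_def\<close>)
  then have "realizes N b P" by (auto simp: realizes_def)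
  then have "realizes N b p" unfolding P_def realizes_norm .
  then show "\<exists>b\<in>carrier N. realizes N b p" using b(1) by blast
qed

end

lemma saturated_mono:
  fixes L :: "('f, 'r) language" and M :: "('f, 'r, 'm) struct"
  assumes "saturated L \<mu> M" "\<kappa> \<le>o \<mu>"
  shows "saturated L \<kappa> M"
  unfolding saturated_def
proof (intro allI impI)
  fix A and p :: "(('f, 'r) fm \<times> (nat \<Rightarrow> 'm)) set"
  assume "A \<subseteq> carrier M" "|A| <o \<kappa>" "p \<subseteq> param_fms L A"
    "\<forall>q. finite q \<longrightarrow> q \<subseteq> p \<longrightarrow> (\<exists>b\<in>carrier M. realizes M b q)"
  moreover have "|A| <o \<mu>" using \<open>|A| <o \<kappa>\<close> assms(2) ordLess_ordLeq_trans by blast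
  ultimately show "\<exists>b\<in>carrier M. realizes M b p" using assms(1) unfolding saturated_def by blast
qed

lemma saturated_fills_gaps:
  fixes L :: "('f, 'r) language" and M :: "('f, 'r, 'm) struct"
  assumes sat: "saturated L \<mu> M" and lt: "(lt, 2) \<in> rels L" and dense: "dense_linear_order (ord_of M lt)"
    and \<kappa>: "Card_order \<kappa>" "infinite (Field \<kappa>)" "\<kappa> <o \<mu>"
  shows "fills_gaps (ord_of M lt) \<kappa>"
  unfolding fills_gaps_def
proof (intro allI impI)
  let ?R = "ord_of M lt"
  fix A B assume ne: "A \<noteq> {}" "B \<noteq> {}" and small: "|A| \<le>o \<kappa>" "|B| \<le>o \<kappa>" and AB: "A \<times> B \<subseteq> ?R"
  have C: "A \<subseteq> carrier M" "B \<subseteq> carrier M" and FR: "A \<subseteq> Field ?R" "B \<subseteq> Field ?R"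
    using AB ne by (auto simp: ord_of_def Field_def)
  define above where "above a = (Rel lt [Var 1, Var 0] :: ('f, 'r) fm, \<lambda>_ :: nat. a)" for a :: 'm
  define below where "below b = (Rel lt [Var 0, Var 1] :: ('f, 'r) fm, \<lambda>_ :: nat. b)" for b :: 'm
  have mem: "above a \<in> q \<Longrightarrow> a \<in> A" "below a \<in> q \<Longrightarrow> a \<in> B" if "q \<subseteq> above ` A \<union> below ` B" for a q
  proof -
    have eqs: "above a = above a' \<longleftrightarrow> a = a'" "below a = below a' \<longleftrightarrow> a = a'" "above a \<noteq> below a'" for a a'
      by (auto simp: above_def below_def fun_eq_iff)
    show "above a \<in> q \<Longrightarrow> a \<in> A" "below a \<in> q \<Longrightarrow> a \<in> B"
      using subsetD[OF that, of "above a"] subsetD[OF that, of "below a"] eqs(3) eqs(3)[symmetric]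
      by (auto simp: eqs(1,2))
  qed
  have sat_above: "(case above a of (\<phi>, e) \<Rightarrow> sat M (e(0 := x)) \<phi>) \<longleftrightarrow> (a, x) \<in> ?R" if "a \<in> A" "x \<in> carrier M" for a x
    using that C by (auto simp: above_def ord_of_def)
  have sat_below: "(case below b of (\<phi>, e) \<Rightarrow> sat M (e(0 := x)) \<phi>) \<longleftrightarrow> (x, b) \<in> ?R" if "b \<in> B" "x \<in> carrier M" for b x
    using that C by (auto simp: below_def ord_of_def)
  have real: "realizes M x q \<longleftrightarrow> (\<forall>a. above a \<in> q \<longrightarrow> (a, x) \<in> ?R) \<and> (\<forall>b. below b \<in> q \<longrightarrow> (x, b) \<in> ?R)"
    if x: "x \<in> carrier M" and q: "q \<subseteq> above ` A \<union> below ` B" for x q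
  proof
    assume r: "realizes M x q"
    have "(a, x) \<in> ?R" if a: "above a \<in> q" for a
      using bspec[OF r[unfolded realizes_def] a] unfolding sat_above[OF mem(1)[OF q a] x] .
    moreover have "(x, b) \<in> ?R" if b: "below b \<in> q" for b
      using bspec[OF r[unfolded realizes_def] b] unfolding sat_below[OF mem(2)[OF q b] x] .
    ultimately show "(\<forall>a. above a \<in> q \<longrightarrow> (a, x) \<in> ?R) \<and> (\<forall>b. below b \<in> q \<longrightarrow> (x, b) \<in> ?R)" by blast
  next
    assume *: "(\<forall>a. above a \<in> q \<longrightarrow> (a, x) \<in> ?R) \<and> (\<forall>b. below b \<in> q \<longrightarrow> (x, b) \<in> ?R)"
    show "realizes M x q"
      unfolding realizes_def
    proof
      fix z assume "z \<in> q"
      then consider a where "a \<in> A" "z = above a" | b where "b \<in> B" "z = below b" using q by blast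
      then show "case z of (\<phi>, e) \<Rightarrow> sat M (e(0 := x)) \<phi>"
      proof cases
        case 1
        show ?thesis unfolding 1(2) sat_above[OF 1(1) x] using * \<open>z \<in> q\<close> 1(2) by blast
      next
        case 2
        show ?thesis unfolding 2(2) sat_below[OF 2(1) x] using * \<open>z \<in> q\<close> 2(2) by blast
      qed
    qed
  qed
  let ?p = "above ` A \<union> below ` B"
  have "|A \<union> B| \<le>o \<kappa>" by (rule card_of_Un_ordLeq_infinite_Field[OF \<kappa>(2) small \<kappa>(1)])
  then have AB_small: "|A \<union> B| <o \<mu>" using \<kappa>(3) ordLeq_ordLess_trans by blast
  have params: "?p \<subseteq> param_fms L (A \<union> B)"
    using lt by (auto simp: param_fms_def above_def below_def numeral_2_eq_2)
  have "\<exists>x\<in>carrier M. realizes M x q" if q: "finite q" "q \<subseteq> ?p" for q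
  proof -
    \<comment> \<open>\<open>a\<close> and \<open>b\<close> ensure that there is a maximum and a minimum when \<open>q\<close> bounds on one side only.\<close>
    obtain a b where ab: "a \<in> A" "b \<in> B" using ne by blast
    let ?A = "insert a {x. above x \<in> q}" and ?B = "insert b {x. below x \<in> q}"
    have sub: "?A \<subseteq> A" "?B \<subseteq> B" using mem[OF q(2)] ab by auto
    have "{x. above x \<in> q} \<subseteq> (\<lambda>(\<phi>, e). e 0) ` q" "{x. below x \<in> q} \<subseteq> (\<lambda>(\<phi>, e). e 0) ` q"
      by (force simp: above_def below_def)+
    then have fin: "finite ?A" "finite ?B" using q(1) finite_subset by blast+
    have subF: "?A \<subseteq> Field ?R" "?B \<subseteq> Field ?R" using subset_trans[OF sub(1) FR(1)] subset_trans[OF sub(2) FR(2)] .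
    obtain m where m: "m \<in> ?A" "\<forall>x\<in>?A. x = m \<or> (x, m) \<in> ?R"
      using finite_has_maximum[OF dense fin(1) insert_not_empty subF(1)] by (elim bexE)
    obtain m' where m': "m' \<in> ?B" "\<forall>x\<in>?B. x = m' \<or> (m', x) \<in> ?R"
      using finite_has_minimum[OF dense fin(2) insert_not_empty subF(2)] by (elim bexE)
    have "(m, m') \<in> ?R" using m(1) m'(1) sub AB by blast
    then obtain z where z: "(m, z) \<in> ?R" "(z, m') \<in> ?R" using dense_linear_orderD(5)[OF dense] by blast
    note tr = transD[OF dense_linear_orderD(1)[OF dense]]
    have "\<forall>x\<in>?A. (x, z) \<in> ?R" "\<forall>x\<in>?B. (z, x) \<in> ?R" using m(2) m'(2) z tr by metis+
    moreover have zc: "z \<in> carrier M" using z by (simp add: ord_of_def)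
    ultimately show ?thesis using real[OF zc q(2)] by blast
  qed
  then obtain x where x: "x \<in> carrier M" "realizes M x ?p"
    using sat[unfolded saturated_def, rule_format, of "A \<union> B" ?p] AB_small params C by blast
  then have "\<forall>a\<in>A. \<forall>b\<in>B. (a, x) \<in> ?R \<and> (x, b) \<in> ?R" using real[OF x(1) subset_refl] by blast
  then show "\<exists>x. \<forall>a\<in>A. \<forall>b\<in>B. (a, x) \<in> ?R \<and> (x, b) \<in> ?R" by blast
qed

section \<open>Iterated ultrapowers\<close>

theorem theorem9p3:
  fixes L :: "('f, 'r) language"
    and lt :: 'r
    and n :: nat
    and lam :: "'k rel"
    and \<kappa> :: "nat \<Rightarrow> 'k rel"
    and E :: "nat \<Rightarrow> 'k set set"
    and M :: "nat \<Rightarrow> ('f, 'r, 'm) struct"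
  assumes language: "countable_language L" "(lt, 2) \<in> rels L"
    and cardinals: "Card_order lam" "\<And>l. l \<le> n \<Longrightarrow> uncountable_cardinal (\<kappa> l)"
    and decreasing: "\<kappa> 0 <o lam" "\<And>l. l < n \<Longrightarrow> \<kappa> (Suc l) <o \<kappa> l"
    and ultrafilters: "\<And>l. l \<le> n \<Longrightarrow>
          ultrafilter_on (Field (\<kappa> l)) (E l) \<and>
          nonprincipal_on (Field (\<kappa> l)) (E l) \<and>
          complete_on (Field (\<kappa> l)) (\<kappa> l) (E l) \<and>
          normal_on (\<kappa> l) (E l)"
    and M0: "is_model L (M 0)" "saturated L lam (M 0)" "dense_linear_order (ord_of (M 0) lt)"
    and ultrapowers: "\<And>l. l \<le> n \<Longrightarrow>
          is_model L (M (Suc l)) \<and>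
          isomorphic L (M (Suc l)) (ultrapower (Field (\<kappa> l)) (E l) (M l))"
  shows
    "(\<forall>l\<le>n. saturated L (\<kappa> l) (M (Suc l))) \<and>
     (\<forall>l k. l < k \<longrightarrow> k \<le> n + 1 \<longrightarrow>
        has_cut (ord_of (M k) lt) (cardSuc (\<kappa> l)) (cardSuc (\<kappa> l))) \<and>
     (\<forall>i\<le>n. \<forall>l\<le>n + 1. \<not> has_cut (ord_of (M l) lt) (\<kappa> i) (\<kappa> i)) \<and>
     (\<forall>l\<le>n + 1. \<forall>\<theta> :: 'k rel. weakly_compact \<theta> \<longrightarrow> \<theta> <o lam \<longrightarrow>
        \<not> has_cut (ord_of (M l) lt) \<theta> \<theta>) \<and>
     (\<forall>l\<le>n. has_cut (ord_of (M (n + 1)) lt) (cardSuc (\<kappa> l)) (cardSuc (\<kappa> l))) \<and>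
     (\<forall>\<theta> :: 'k rel. weakly_compact \<theta> \<longrightarrow> \<theta> <o lam \<longrightarrow>
        \<not> has_cut (ord_of (M (n + 1)) lt) \<theta> \<theta>) \<and>
     (\<forall>l\<le>n. weakly_compact (\<kappa> l) \<and> \<not> has_cut (ord_of (M (n + 1)) lt) (\<kappa> l) (\<kappa> l))"
proof -
  define R where "R l = ord_of (M l) lt" for l
  have measure: "normal_measure (\<kappa> l) (E l)" if "l \<le> n" for l
    using cardinals(2)[OF that] ultrafilters[OF that] by (simp add: normal_measure_def)
  note Card = normal_measure.Card[OF measure] and inf = normal_measure.inf[OF measure]
  have model: "is_model L (M l)" if "l \<le> n + 1" for l
    using M0(1) ultrapowers[of "l - 1"] that by (cases l) auto
  have less: "\<kappa> k <o \<kappa> l" if "l < k" "k \<le> n" for l k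
    using that
  proof (induction k)
    case (Suc k)
    then have step: "\<kappa> (Suc k) <o \<kappa> k" using decreasing(2) by simp
    show ?case
    proof (cases "l = k")
      case False
      then have "\<kappa> k <o \<kappa> l" using Suc by simp
      with step show ?thesis by (rule ordLess_transitive)
    qed (use step in simp)
  qed simp
  have less_lam: "\<kappa> l <o lam" if "l \<le> n" for l
    using less[of 0 l] that decreasing(1) ordLess_transitive[of "\<kappa> l" "\<kappa> 0" lam] by (cases "l = 0") auto
  have ultra: "\<exists>rep. normal_model_ultrapower (\<kappa> l) (E l) L (M l) (M (Suc l)) rep" if l: "l \<le> n" for l
  proof -
    have "ultrafilter_on (Field (\<kappa> l)) (E l)" "is_model L (M (Suc l))"
      "isomorphic L (M (Suc l)) (ultrapower (Field (\<kappa> l)) (E l) (M l))"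
      using ultrafilters[OF l] ultrapowers[OF l] by auto
    from ultrapower_representation[OF this(1) model this(2,3)] l
    obtain rep where "model_ultrapower L (M l) (M (Suc l)) (ufilter (Field (\<kappa> l)) (E l)) rep" by auto
    then show ?thesis using normal_model_ultrapower.intro[OF measure[OF l]] by blast
  qed
  have order: "\<exists>rep. normal_order_ultrapower (\<kappa> l) (E l) (R l) (R (Suc l)) rep"
    if l: "l \<le> n" and dense: "dense_linear_order (R l)" for l
  proof -
    obtain rep where "normal_model_ultrapower (\<kappa> l) (E l) L (M l) (M (Suc l)) rep" using ultra[OF l] by blast
    then have "model_ultrapower L (M l) (M (Suc l)) (ufilter (Field (\<kappa> l)) (E l)) rep"
      by (rule normal_model_ultrapower.axioms)
    from model_ultrapower.ord_of_ultrapower[OF this language(2) dense[unfolded R_def]]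
    show ?thesis unfolding R_def using normal_order_ultrapower.intro[OF measure[OF l]] by blast
  qed
  \<comment> \<open>\<open>M l\<close> is saturated at a cardinal above \<open>\<kappa> l\<close>: at \<open>lam\<close> for \<open>l = 0\<close>, and at \<open>\<kappa> (l - 1)\<close> after that.\<close>
  have invariant: "dense_linear_order (R l) \<and> saturated L (\<kappa> l) (M l) \<and> fills_gaps (R l) (\<kappa> l)" if "l \<le> n" for l
    using that
  proof (induction l)
    case 0
    then show ?case
      using M0 saturated_mono[OF M0(2) ordLess_imp_ordLeq[OF decreasing(1)]]
        saturated_fills_gaps[OF M0(2) language(2) M0(3) Card inf decreasing(1)] by (simp add: R_def)
  next
    case (Suc l)
    then have l: "l \<le> n" "\<kappa> (Suc l) <o \<kappa> l" using decreasing(2) by auto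
    have IH: "dense_linear_order (R l)" "saturated L (\<kappa> l) (M l)" using Suc by auto
    obtain rep where "normal_model_ultrapower (\<kappa> l) (E l) L (M l) (M (Suc l)) rep" using ultra[OF l(1)] by blast
    from normal_model_ultrapower.saturated_ultrapower[OF this language(1) IH(2)]
    have sat: "saturated L (\<kappa> l) (M (Suc l))" .
    obtain rep' where "normal_order_ultrapower (\<kappa> l) (E l) (R l) (R (Suc l)) rep'" using order[OF l(1) IH(1)] by blast
    then have "order_ultrapower (R l) (R (Suc l)) (ufilter (Field (\<kappa> l)) (E l)) rep'"
      by (rule normal_order_ultrapower.axioms)
    then have dense: "dense_linear_order (R (Suc l))" by (rule order_ultrapower.S_dense_linear_order)
    then show ?case
      using saturated_mono[OF sat ordLess_imp_ordLeq[OF l(2)]]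
        saturated_fills_gaps[OF sat language(2) dense[unfolded R_def] Card inf l(2)] Suc.prems
      by (simp add: R_def)
  qed
  have sat: "saturated L (\<kappa> l) (M (Suc l))" if l: "l \<le> n" for l
  proof -
    obtain rep where "normal_model_ultrapower (\<kappa> l) (E l) L (M l) (M (Suc l)) rep" using ultra[OF l] by blast
    from normal_model_ultrapower.saturated_ultrapower[OF this language(1)] invariant[OF l] show ?thesis by blast
  qed
  obtain rep where rep: "\<And>l. l \<le> n \<Longrightarrow> normal_order_ultrapower (\<kappa> l) (E l) (R l) (R (Suc l)) (rep l)"
    using order invariant by metis
  note rep_order = normal_order_ultrapower.axioms(2)[OF rep]
  have cut: "has_cut (R k) (cardSuc (\<kappa> l)) (cardSuc (\<kappa> l))" if "l < k" "k \<le> n + 1" for l k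
    using that
  proof (induction k)
    case (Suc k)
    show ?case
    proof (cases "l = k")
      case True
      then have "k \<le> n" "fills_gaps (R k) (\<kappa> k)" using Suc.prems invariant by auto
      then show ?thesis using normal_order_ultrapower.cut_at_cardSuc[OF rep] True by blast
    next
      case False
      then have k: "l < k" "k \<le> n" "l \<le> n" using Suc.prems by auto
      let ?K = "cardSuc (\<kappa> l)"
      have K: "Card_order ?K" "infinite (Field ?K)" "regularCard ?K"
        using cardSuc_Card_order[OF Card[OF k(3)]] cardSuc_finite[OF Card[OF k(3)]] inf[OF k(3)]
          infinite_cardSuc_regularCard[OF inf[OF k(3)] Card[OF k(3)]] by auto
      have "|Field (\<kappa> k)| <o ?K"
        using ordIso_ordLess_trans[OF card_of_Field_ordIso[OF Card[OF k(2)]]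
            ordLess_transitive[OF less[OF k(1,2)] cardSuc_greater[OF Card[OF k(3)]]]] .
      moreover have "\<forall>\<^sub>F i in ufilter (Field (\<kappa> k)) (E k). i \<in> Field (\<kappa> k)"
        using normal_measure.F_in[OF measure[OF k(2)]] .
      moreover have "has_cut (R k) ?K ?K" using Suc.IH k by simp
      ultimately show ?thesis
        using order_ultrapower.cut_preserved[OF rep_order[OF k(2)] _ K] by blast
    qed
  qed simp
  have no_cut: "\<not> has_cut (R l) \<theta> \<theta>" if "l \<le> n + 1" and \<theta>: "weakly_compact \<theta>" "\<theta> <o lam" for l and \<theta> :: "'k rel"
    using that(1)
  proof (induction l)
    interpret weakly_compact_cardinal \<theta> using \<theta>(1) by unfold_locales
    have self: "\<theta> \<le>o \<theta>" and ne: "Field \<theta> \<noteq> {}" using ordLeq_reflexive[OF wo] inf by auto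
    {
      case 0
      have "fills_gaps (R 0) \<theta>"
        unfolding R_def by (rule saturated_fills_gaps[OF M0(2) language(2) M0(3) Card inf \<theta>(2)])
      then show ?case using fills_gaps_no_cut[OF _ Card Card self ne] by blast
    next
      case (Suc l)
      then have l: "l \<le> n" and IH: "\<not> has_cut (R l) \<theta> \<theta>" by auto
      have measure_l: "normal_measure (\<kappa> l) (E l)" by (rule measure[OF l])
      have dense: "dense_linear_order (R (Suc l))"
        by (rule order_ultrapower.S_dense_linear_order[OF rep_order[OF l]])
      have W: "Well_order (\<kappa> l)" by (rule normal_measure.wo[OF measure_l])
      consider "\<theta> <o \<kappa> l" | "\<theta> =o \<kappa> l" | "\<kappa> l <o \<theta>"
        using ordLess_or_ordLeq[OF W wo] ordLeq_iff_ordLess_or_ordIso by blast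
      then show ?case
      proof cases
        \<comment> \<open>By saturation of the ultrapower below \<open>\<kappa> l\<close>, by normality at \<open>\<kappa> l\<close>, and by weak
          compactness and induction above \<open>\<kappa> l\<close>.\<close>
        case 1
        have "fills_gaps (R (Suc l)) \<theta>"
          unfolding R_def by (rule saturated_fills_gaps[OF sat[OF l] language(2) dense[unfolded R_def] Card inf 1])
        then show ?thesis using fills_gaps_no_cut[OF _ Card Card self ne] by blast
      next
        case 2
        have "\<not> has_cut (R (Suc l)) (\<kappa> l) (\<kappa> l)"
          using normal_order_ultrapower.no_cut_at_measure[OF rep[OF l]] invariant[OF l] by blast
        then show ?thesis using has_cut_ordIso[OF _ 2] by blast
      next
        case 3
        have "|Field (\<kappa> l)| <o \<theta>"
          using ordIso_ordLess_trans[OF card_of_Field_ordIso[OF normal_measure.Card[OF measure_l]] 3] .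
        then show ?thesis
          using order_ultrapower.weakly_compact_no_cut[OF rep_order[OF l] \<theta>(1) normal_measure.F_in[OF measure_l] _ IH]
          by blast
      qed
    }
  qed
  have wc: "weakly_compact (\<kappa> l)" if "l \<le> n" for l
    by (rule normal_measure.weakly_compact[OF measure[OF that]])
  show ?thesis
    using sat cut[unfolded R_def] no_cut[unfolded R_def] wc less_lam by auto
qed

end
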